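(* Let $\mathbb{F}_q$ be a finite field, let $m\geq 1$, and let $w=(w_0,w_1,\dots,w_m)$ be positive integers with $1=w_0\leq w_1\leq w_2\leq\cdots\leq w_m$. Then for every integer $d\geq 1$, \[ e_q(d;1,w_1,\dots,w_m)= \min\left\{p_m,\ \left(\left\lfloor \frac{d-1}{w_1}\right\rfloor+1\right)q^{m-1}+p_{m-2}\right\}. \]
   Context: The weighted projective space $\mathbb{P}(w)$ is the quotient of $\overline{\mathbb{F}_q}^{\,m+1}\setminus\{0\}$ by the action of $\overline{\mathbb{F}_q}^*$ given by $\lambda\cdot(x_0,\dots,x_m)=(\lambda^{w_0}x_0,\dots,\lambda^{w_m}x_m)$. $\mathbb{P}(w)(\mathbb{F}_q)$ is the set of points of $\mathbb{P}(w)$ invariant under the Frobenius $(x_0,\dots,x_m)\mapsto(x_0^q,\dots,x_m^q)$; it has $p_m$ elements, where $p_k:=\frac{q^{k+1}-1}{q-1}$ (so $p_0=1$, $p_{-1}=0$). $\mathbb{F}_q[x_0,\dots,x_m]^w_d$ is the $\mathbb{F}_q$-vector space spanned by the monomials $x_0^{a_0}\cdots x_m^{a_m}$ with $w_0a_0+\cdots+w_ma_m=d$. For $f$ in this space, $V_{\mathbb{P}(w)}(f)(\mathbb{F}_q)$ is the set of points of $\mathbb{P}(w)(\mathbb{F}_q)$ at which $f$ vanishes, and \[e_q(d;w_0,\dots,w_m):=\max\{|V_{\mathbb{P}(w)}(f)(\mathbb{F}_q)| : f\in\mathbb{F}_q[x_0,\dots,x_m]^w_d,\ f\neq 0\}.\]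 *)

theory Defs
  imports
    "HOL-Algebra.Algebraic_Closure_Type"
    "HOL-Library.Poly_Mapping"
    "HOL-Library.FuncSet"
    "HOL-Library.Cardinality"
begin

text \<open>
  The finite field \<open>F\<^sub>q\<close> is a type \<open>'a :: {finite,field}\<close> with \<open>q = CARD('a)\<close>, and its algebraic
  closure is \<open>'a alg_closure\<close>.  Vectors with coordinates \<open>0,\<dots>,m\<close> are extensional functions on
  \<open>{..m}\<close>.
\<close>

definition punctured_space :: "nat \<Rightarrow> (nat \<Rightarrow> 'a::field alg_closure) set" where
  "punctured_space m = {x \<in> {..m} \<rightarrow>\<^sub>E UNIV. \<exists>i\<le>m. x i \<noteq> 0}"

definition wp_rel ::
    "nat \<Rightarrow> (nat \<Rightarrow> nat) \<Rightarrow> ((nat \<Rightarrow> 'a::field alg_closure) \<times> (nat \<Rightarrow> 'a alg_closure)) set" where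
  "wp_rel m w = {(x, y). x \<in> punctured_space m \<and> y \<in> punctured_space m \<and>
     (\<exists>c. c \<noteq> 0 \<and> (\<forall>i\<le>m. y i = c ^ w i * x i))}"

definition weighted_proj_space :: "nat \<Rightarrow> (nat \<Rightarrow> nat) \<Rightarrow> (nat \<Rightarrow> 'a::field alg_closure) set set" where
  "weighted_proj_space m w = punctured_space m // wp_rel m w"

lemma equiv_wp_rel:
  "equiv (punctured_space m :: (nat \<Rightarrow> 'a::field alg_closure) set) (wp_rel m w)" (is "equiv ?A ?r")
proof (rule equivI)
  show "?r \<subseteq> ?A \<times> ?A"
    by (auto simp: wp_rel_def)
  show "refl_on ?A ?r"
    by (auto simp: refl_on_def wp_rel_def intro!: exI[of _ 1])
  show "sym ?r"
  proof (rule symI)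
    fix x y :: "nat \<Rightarrow> 'a alg_closure"
    assume "(x, y) \<in> wp_rel m w"
    then obtain c where c: "x \<in> punctured_space m" "y \<in> punctured_space m" "c \<noteq> 0"
      "\<forall>i\<le>m. y i = c ^ w i * x i" by (auto simp: wp_rel_def)
    then have "\<forall>i\<le>m. x i = inverse c ^ w i * y i"
      by (auto simp: power_inverse field_simps)
    moreover have "inverse c \<noteq> 0"
      using c by simp
    ultimately show "(y, x) \<in> wp_rel m w"
      using c(1,2) unfolding wp_rel_def by blast
  qed
  show "trans ?r"
  proof (rule transI)
    fix x y z :: "nat \<Rightarrow> 'a alg_closure"
    assume "(x, y) \<in> wp_rel m w" "(y, z) \<in> wp_rel m w"
    then obtain c c' where c: "x \<in> punctured_space m" "z \<in> punctured_space m" "c \<noteq> 0" "c' \<noteq> 0"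
      "\<forall>i\<le>m. y i = c ^ w i * x i" "\<forall>i\<le>m. z i = c' ^ w i * y i" by (auto simp: wp_rel_def)
    then have "\<forall>i\<le>m. z i = (c' * c) ^ w i * x i"
      by (auto simp: power_mult_distrib)
    moreover have "c' * c \<noteq> 0"
      using c by simp
    ultimately show "(x, z) \<in> wp_rel m w"
      using c(1,2) unfolding wp_rel_def by blast
  qed
qed

definition frob :: "nat \<Rightarrow> (nat \<Rightarrow> 'a::{finite,field} alg_closure) \<Rightarrow> nat \<Rightarrow> 'a alg_closure" where
  "frob m x = (\<lambda>i\<in>{..m}. x i ^ CARD('a))"

text \<open>The map induced on classes: since \<open>frob\<close> respects \<open>wp_rel\<close>, all the sets in this union coincide.\<close>

definition frob_class :: "nat \<Rightarrow> (nat \<Rightarrow> nat) \<Rightarrow>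
    (nat \<Rightarrow> 'a::{finite,field} alg_closure) set \<Rightarrow> (nat \<Rightarrow> 'a alg_closure) set" where
  "frob_class m w P = (\<Union>x\<in>P. wp_rel m w `` {frob m x})"

lemma congruent_frob:
  "(\<lambda>x :: nat \<Rightarrow> 'a::{finite,field} alg_closure. wp_rel m w `` {frob m x}) respects wp_rel m w"
proof (rule congruentI)
  fix x y :: "nat \<Rightarrow> 'a alg_closure"
  assume "(x, y) \<in> wp_rel m w"
  then obtain c where c: "x \<in> punctured_space m" "y \<in> punctured_space m" "c \<noteq> 0"
      "\<forall>i\<le>m. y i = c ^ w i * x i" by (auto simp: wp_rel_def)
  have "frob m z \<in> punctured_space m" if "z \<in> punctured_space m" for z :: "nat \<Rightarrow> 'a alg_closure"
    using that by (auto simp: punctured_space_def frob_def)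
  moreover have "\<forall>i\<le>m. frob m y i = (c ^ CARD('a)) ^ w i * frob m x i"
    using c(4) by (auto simp: frob_def power_mult_distrib mult.commute simp flip: power_mult)
  moreover have "c ^ CARD('a) \<noteq> 0"
    using c by simp
  ultimately have "(frob m x, frob m y) \<in> wp_rel m w"
    using c(1,2) unfolding wp_rel_def by blast
  then show "wp_rel m w `` {frob m x} = wp_rel m w `` {frob m y}"
    by (rule equiv_class_eq[OF equiv_wp_rel])
qed

definition rational_points ::
    "nat \<Rightarrow> (nat \<Rightarrow> nat) \<Rightarrow> (nat \<Rightarrow> 'a::{finite,field} alg_closure) set set" where
  "rational_points m w = {P \<in> weighted_proj_space m w. frob_class m w P = P}"

text \<open>
  Polynomials in the variables \<open>x\<^sub>0, x\<^sub>1, \<dots>\<close> over \<open>'a\<close> are finitely supported functions from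
  exponent vectors to coefficients.
\<close>

type_synonym 'a mpoly = "(nat \<Rightarrow>\<^sub>0 nat) \<Rightarrow>\<^sub>0 'a"

definition weighted_exponents :: "nat \<Rightarrow> (nat \<Rightarrow> nat) \<Rightarrow> nat \<Rightarrow> (nat \<Rightarrow>\<^sub>0 nat) set" where
  "weighted_exponents m w d =
     {a. Poly_Mapping.keys a \<subseteq> {..m} \<and> (\<Sum>i\<le>m. w i * Poly_Mapping.lookup a i) = d}"

text \<open>Multiplication by the constant polynomial \<open>c\<close> is the scalar multiplication by \<open>c\<close>.\<close>

definition mpoly_scale :: "'a::field \<Rightarrow> 'a mpoly \<Rightarrow> 'a mpoly" where
  "mpoly_scale c f = Poly_Mapping.single 0 c * f"

interpretation mpoly: vector_space mpoly_scale
  by unfold_locales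
    (simp_all add: mpoly_scale_def algebra_simps single_add mult_single flip: mult.assoc)

definition weighted_homogeneous :: "nat \<Rightarrow> (nat \<Rightarrow> nat) \<Rightarrow> nat \<Rightarrow> 'a::field mpoly set" where
  "weighted_homogeneous m w d =
     mpoly.span ((\<lambda>a. Poly_Mapping.single a 1) ` weighted_exponents m w d)"

lemma lookup_mpoly_scale:
  "Poly_Mapping.lookup (mpoly_scale c f) a = c * Poly_Mapping.lookup f a"
proof -
  have "mpoly_scale c f = Poly_Mapping.map ((*) c) f"
    by (simp add: mpoly_scale_def mult_map_scale_conv_mult)
  then show ?thesis
    by (simp add: map.rep_eq when_def)
qed

lemma weighted_homogeneous_iff:
  "f \<in> weighted_homogeneous m w d \<longleftrightarrow> Poly_Mapping.keys f \<subseteq> weighted_exponents m w d"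
proof
  assume "f \<in> weighted_homogeneous m w d"
  then show "Poly_Mapping.keys f \<subseteq> weighted_exponents m w d"
    unfolding weighted_homogeneous_def
  proof (induction rule: mpoly.span_induct_alt)
    case (step c x y)
    then obtain a where a: "x = Poly_Mapping.single a 1" "a \<in> weighted_exponents m w d" by auto
    have "Poly_Mapping.keys (mpoly_scale c x) \<subseteq> {a}"
      by (auto simp: a in_keys_iff lookup_mpoly_scale lookup_single when_def split: if_splits)
    with step a keys_add[of "mpoly_scale c x" y] show ?case by blast
  qed auto
next
  assume keys: "Poly_Mapping.keys f \<subseteq> weighted_exponents m w d"
  have "f = (\<Sum>a\<in>Poly_Mapping.keys f. mpoly_scale (Poly_Mapping.lookup f a) (Poly_Mapping.single a 1))"
    by (rule poly_mapping_eqI)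
      (auto simp: lookup_sum lookup_mpoly_scale lookup_single when_def in_keys_iff
        if_distrib[of "\<lambda>t. _ * t"] cong: if_cong)
  also have "\<dots> \<in> weighted_homogeneous m w d"
    unfolding weighted_homogeneous_def
    using keys by (intro mpoly.span_sum mpoly.span_scale mpoly.span_base) auto
  finally show "f \<in> weighted_homogeneous m w d" .
qed

definition eval_ac :: "nat \<Rightarrow> 'a::field mpoly \<Rightarrow> (nat \<Rightarrow> 'a alg_closure) \<Rightarrow> 'a alg_closure" where
  "eval_ac m f x = (\<Sum>a\<in>Poly_Mapping.keys f.
     to_ac (Poly_Mapping.lookup f a) * (\<Prod>i\<le>m. x i ^ Poly_Mapping.lookup a i))"

text \<open>For weighted homogeneous \<open>f\<close>, vanishing at one representative of a point implies vanishing at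
  all of them.\<close>

definition rational_zeros :: "nat \<Rightarrow> (nat \<Rightarrow> nat) \<Rightarrow> 'a::{finite,field} mpoly \<Rightarrow>
    (nat \<Rightarrow> 'a alg_closure) set set" where
  "rational_zeros m w f = {P \<in> rational_points m w. \<forall>x\<in>P. eval_ac m f x = 0}"

lemma eval_ac_wp_rel:
  assumes "f \<in> weighted_homogeneous m w d" and "\<forall>i\<le>m. y i = c ^ w i * x i"
  shows "eval_ac m f y = c ^ d * eval_ac m f x"
proof -
  have "(\<Prod>i\<le>m. y i ^ Poly_Mapping.lookup a i) = c ^ d * (\<Prod>i\<le>m. x i ^ Poly_Mapping.lookup a i)"
    if "a \<in> Poly_Mapping.keys f" for a
  proof -
    have "(\<Prod>i\<le>m. y i ^ Poly_Mapping.lookup a i) =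
        (\<Prod>i\<le>m. c ^ (w i * Poly_Mapping.lookup a i)) * (\<Prod>i\<le>m. x i ^ Poly_Mapping.lookup a i)"
      unfolding prod.distrib[symmetric] using assms(2)
      by (intro prod.cong) (auto simp: power_mult_distrib power_mult)
    also have "(\<Prod>i\<le>m. c ^ (w i * Poly_Mapping.lookup a i)) = c ^ d"
      using that assms(1) unfolding power_sum[symmetric]
      by (auto simp: weighted_homogeneous_iff weighted_exponents_def)
    finally show ?thesis .
  qed
  then show ?thesis
    by (simp add: eval_ac_def sum_distrib_left mult_ac)
qed

text \<open>\<open>e\<^sub>q(d; w\<^sub>0, \<dots>, w\<^sub>m)\<close> for the field \<open>'a\<close> with \<open>q\<close> elements.\<close>

definition e_max :: "'a::{finite,field} itself \<Rightarrow> nat \<Rightarrow> nat \<Rightarrow> (nat \<Rightarrow> nat) \<Rightarrow> nat" where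
  "e_max _ d m w =
     Max {card (rational_zeros m w f) | f :: 'a mpoly. f \<in> weighted_homogeneous m w d \<and> f \<noteq> 0}"

text \<open>The index is an integer because \<open>p\<^bsub>-1\<^esub> = 0\<close> is needed; the division is exact.\<close>

definition p_num :: "nat \<Rightarrow> int \<Rightarrow> nat" where
  "p_num q k = (q ^ nat (k + 1) - 1) div (q - 1)"

end

theory Submission
  imports Defs
begin

text \<open>
  By Lang's theorem every rational point of the weighted projective space has exactly \<open>q - 1\<close>
  representatives in \<open>F\<^sub>q\<^bsup>m + 1\<^esup>\<close>.  With \<open>k = (d - 1) div w\<^sub>1 < q\<close>, the claim therefore says that a
  nonzero form \<open>f\<close> of degree \<open>d\<close> has at least \<open>(q - 1) (q - k) q\<^bsup>m - 1\<^esup>\<close> nonzeros in \<open>F\<^sub>q\<^bsup>m + 1\<^esup>\<close>, with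
  equality for \<open>x\<^sub>0\<^bsup>d - k w\<^sub>1\<^esup> \<Prod> (x\<^sub>1 - a x\<^sub>0\<^bsup>w\<^sub>1\<^esup>)\<close>, where \<open>a\<close> ranges over \<open>k\<close> elements of \<open>F\<^sub>q\<close>.

  For fixed \<open>x\<^sub>0 = c\<close>, a lexicographically leading monomial \<open>\<mu>\<close> in \<open>x\<^sub>1, \<dots>, x\<^sub>m\<close> gives at least
  \<open>\<Prod> (q - \<mu>\<^sub>i)\<close> nonzeros.  The degree in \<open>x\<^sub>1, \<dots>, x\<^sub>m\<close> is at most \<open>k + 1\<close>, and this bound suffices unless
  \<open>\<mu>\<close> is a pure power \<open>x\<^sub>p\<^bsup>k + 1\<^esup>\<close>.  Suppose that \<open>f\<close> contains two such powers \<open>x\<^sub>p\<^bsup>k + 1\<^esup>\<close> and \<open>x\<^sub>j\<^bsup>k + 1\<^esup>\<close>.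
  If the part of \<open>f\<close> in \<open>x\<^sub>p, x\<^sub>j\<close> alone, a binary form, has no nontrivial zero over \<open>F\<^sub>q\<close>, then fixing the
  other variables and counting standard monomials of the ideal of zeros in the plane gives the
  bound.  If it has a zero \<open>(r, 1)\<close>, the substitution \<open>x\<^sub>p \<rightarrow> x\<^sub>p + r x\<^sub>j\<close> removes \<open>x\<^sub>j\<^bsup>k + 1\<^esup>\<close>.  So only
  one pure power \<open>x\<^sub>p\<^bsup>k + 1\<^esup>\<close> need remain; with \<open>x\<^sub>p\<close> last in the order it can lead a slice only if the
  slice is a polynomial in \<open>x\<^sub>p\<close> alone, and then the nonzeros are counted directly.
\<close>

section \<open>Frobenius on a finite field\<close>

lemma finite_field_power_card_minus_1:
  fixes a :: "'a::{finite,field}"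
  assumes "a \<noteq> 0"
  shows "a ^ (CARD('a) - 1) = 1"
proof -
  have "bij_betw ((*) a) (UNIV - {0}) (UNIV - {0})"
    using assms by (intro bij_betwI[of _ _ _ "\<lambda>x. x / a"]) auto
  then have "(\<Prod>x\<in>UNIV-{0}. a * x) = (\<Prod>x\<in>UNIV-{0}. x)"
    by (rule prod.reindex_bij_betw)
  moreover have "(\<Prod>x\<in>UNIV-{0::'a}. x) \<noteq> 0"
    by simp
  ultimately show ?thesis
    by (simp add: prod.distrib card_Diff_singleton)
qed

lemma finite_field_power_card:
  fixes a :: "'a::{finite,field}"
  shows "a ^ CARD('a) = a"
  using finite_field_power_card_minus_1[of a] power_minus_mult[of "CARD('a)" a]
  by (cases "a = 0") simp_all

lemma card_field_ge_2: "CARD('a::{finite,field}) \<ge> 2"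
proof -
  have "card {0, 1 :: 'a} \<le> CARD('a)"
    by (intro card_mono) auto
  then show ?thesis by simp
qed

text \<open>Both sides are monic of degree \<open>q\<close> and agree on all \<open>q\<close> elements of the field.\<close>

lemma linear_power_card:
  fixes c :: "'a::{finite,field}"
  shows "[:- c, 1:] ^ CARD('a) = monom 1 CARD('a) - [:c:]"
proof (rule poly_eqI_degree_lead_coeff[where A = UNIV and n = "CARD('a)"])
  let ?q = "CARD('a)"
  have q: "?q > 1" using card_field_ge_2[where 'a='a] by simp
  show d: "degree ([:- c, 1:] ^ ?q) \<le> ?q"
    by (simp add: degree_linear_power)
  have "coeff ([:- c, 1:] ^ ?q) ?q = lead_coeff ([:- c, 1:] ^ ?q)"
    by (simp only: degree_linear_power)
  also have "\<dots> = 1"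
    by (subst lead_coeff_power) simp
  finally show "coeff ([:- c, 1:] ^ ?q) ?q = coeff (monom 1 ?q - [:c:]) ?q"
    using q by (simp add: coeff_pCons split: nat.splits)
  show "degree (monom 1 ?q - [:c:]) \<le> ?q"
    by (intro degree_diff_le) (auto simp: degree_monom_le)
qed (simp_all add: poly_monom finite_field_power_card)

section \<open>Standard monomials and anisotropic binary forms\<close>

text \<open>Subspaces of the functions on \<open>Z\<close>, encoded by total functions. The last
  clause closes \<open>R\<close> under changes off \<open>Z\<close>, so identities that hold only on
  \<open>Z\<close> can be used to rewrite members of \<open>R\<close>.\<close>

definition subspace_on :: "'b set \<Rightarrow> ('b \<Rightarrow> 'a::field) set \<Rightarrow> bool" where
  "subspace_on Z R \<longleftrightarrow> (\<lambda>_. 0) \<in> R \<and> (\<forall>f\<in>R. \<forall>g\<in>R. (\<lambda>z. f z + g z) \<in> R) \<and>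
     (\<forall>c. \<forall>f\<in>R. (\<lambda>z. c * f z) \<in> R) \<and> (\<forall>f\<in>R. \<forall>g. (\<forall>z\<in>Z. f z = g z) \<longrightarrow> g \<in> R)"

lemma subspace_onD:
  assumes "subspace_on Z R"
  shows "(\<lambda>_. 0) \<in> R" "f \<in> R \<Longrightarrow> g \<in> R \<Longrightarrow> (\<lambda>z. f z + g z) \<in> R" "f \<in> R \<Longrightarrow> (\<lambda>z. c * f z) \<in> R"
    "f \<in> R \<Longrightarrow> (\<And>z. z \<in> Z \<Longrightarrow> f z = g z) \<Longrightarrow> g \<in> R"
  using assms unfolding subspace_on_def by blast+

lemma subspace_on_sum:
  assumes "subspace_on Z R" "\<And>i. i \<in> I \<Longrightarrow> f i \<in> R"
  shows "(\<lambda>z. \<Sum>i\<in>I. f i z) \<in> R"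
  using assms(2)
  by (induction I rule: infinite_finite_induct)
    (auto intro: subspace_onD[OF assms(1)])

lemma subspace_on_diff:
  assumes "subspace_on Z R" "f \<in> R" "g \<in> R"
  shows "(\<lambda>z. f z - g z) \<in> R"
  using subspace_onD(2)[OF assms(1,2) subspace_onD(3)[OF assms(1,3), of "- 1"]] by simp

text \<open>Lagrange interpolation: with \<open>q\<close> the field size,
  \<open>1 - (x - a) ^ (q - 1)\<close> is the indicator of \<open>a\<close>, and products of two of
  these are the indicators of the points of the plane.\<close>

lemma all_functions_in_span_of_monomials:
  fixes R :: "('a::{finite,field} \<times> 'a \<Rightarrow> 'a) set"
  assumes R: "subspace_on Z R" and mono: "\<And>i j. (\<lambda>(x, y). x ^ i * y ^ j) \<in> R"
  shows "g \<in> R"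
proof -
  define P :: "'a \<Rightarrow> 'a poly" where "P a = 1 - [:- a, 1:] ^ (CARD('a) - 1)" for a
  have P: "poly (P a) x = (if x = a then 1 else 0)" for a x
    using finite_field_power_card_minus_1[of "x - a"] card_field_ge_2[where 'a='a]
    by (auto simp: P_def)
  have prod: "(\<lambda>z. poly (P a) (fst z) * poly (P b) (snd z)) \<in> R" for a b
  proof -
    have "(\<lambda>z. \<Sum>i\<le>degree (P a). \<Sum>j\<le>degree (P b).
        (coeff (P a) i * coeff (P b) j) * (case z of (x, y) \<Rightarrow> x ^ i * y ^ j)) \<in> R"
      by (intro subspace_on_sum[OF R] subspace_onD(3)[OF R] mono)
    then show ?thesis
      by (rule subspace_onD(4)[OF R])
        (simp add: poly_altdef sum_product case_prod_beta mult_ac)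
  qed
  have "(\<lambda>z. \<Sum>w\<in>UNIV. g w * (poly (P (fst w)) (fst z) * poly (P (snd w)) (snd z))) \<in> R"
    by (intro subspace_on_sum[OF R] subspace_onD(3)[OF R] prod)
  moreover have "(\<Sum>w\<in>UNIV. g w * (poly (P (fst w)) (fst z) * poly (P (snd w)) (snd z))) = g z" for z
  proof -
    have "(\<Sum>w\<in>UNIV. g w * (poly (P (fst w)) (fst z) * poly (P (snd w)) (snd z))) =
      (\<Sum>w\<in>UNIV. if w = z then g w else 0)"
      by (intro sum.cong) (auto simp: P prod_eq_iff)
    then show ?thesis by simp
  qed
  ultimately show ?thesis by simp
qed

text \<open>Comparing the numbers of functions on \<open>Z\<close> and on \<open>D\<close> replaces the comparison of dimensions.\<close>

lemma card_le_card_standard_monomials: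
  fixes Z :: "('a::{finite,field} \<times> 'a) set" and D :: "(nat \<times> nat) set"
  assumes "finite D"
    and reducible: "\<And>i j R. (i, j) \<notin> D \<Longrightarrow> subspace_on Z R \<Longrightarrow>
      (\<And>k l. k + l < i + j \<or> k + l = i + j \<and> k < i \<Longrightarrow> (\<lambda>(x, y). x ^ k * y ^ l) \<in> R) \<Longrightarrow>
      (\<lambda>(x, y). x ^ i * y ^ j) \<in> R"
  shows "card Z \<le> card D"
proof -
  define mon :: "nat \<times> nat \<Rightarrow> 'a \<times> 'a \<Rightarrow> 'a" where "mon = (\<lambda>(i, j) (x, y). x ^ i * y ^ j)"
  define R where "R = {g. \<exists>c. \<forall>z\<in>Z. g z = (\<Sum>\<delta>\<in>D. c \<delta> * mon \<delta> z)}"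
  have R: "subspace_on Z R"
    unfolding subspace_on_def
  proof (intro conjI allI impI ballI)
    show "(\<lambda>_. 0) \<in> R"
      unfolding R_def by (intro CollectI exI[of _ "\<lambda>_. 0"]) simp
  next
    fix f g assume "f \<in> R" "g \<in> R"
    then obtain c d where "\<forall>z\<in>Z. f z = (\<Sum>\<delta>\<in>D. c \<delta> * mon \<delta> z)" "\<forall>z\<in>Z. g z = (\<Sum>\<delta>\<in>D. d \<delta> * mon \<delta> z)"
      unfolding R_def by blast
    then show "(\<lambda>z. f z + g z) \<in> R"
      unfolding R_def by (intro CollectI exI[of _ "\<lambda>\<delta>. c \<delta> + d \<delta>"]) (simp add: sum.distrib distrib_right)
  next
    fix a f assume "f \<in> R"
    then obtain c where "\<forall>z\<in>Z. f z = (\<Sum>\<delta>\<in>D. c \<delta> * mon \<delta> z)"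
      unfolding R_def by blast
    then show "(\<lambda>z. a * f z) \<in> R"
      unfolding R_def by (intro CollectI exI[of _ "\<lambda>\<delta>. a * c \<delta>"]) (simp add: sum_distrib_left mult.assoc)
  next
    fix f g assume "f \<in> R" "\<forall>z\<in>Z. f z = g z"
    then show "g \<in> R" unfolding R_def by auto
  qed
  have mon_R: "mon \<mu> \<in> R" for \<mu>
  \<comment> \<open>Monomials are reduced along the graded order that compares total degree first
    and the exponent of \<open>x\<close> second.\<close>
  proof (induction \<mu> rule: wf_induct_rule[OF wf_measures[of "[\<lambda>(i, j). i + j, fst]"]])
    case (1 \<mu>)
    obtain i j where \<mu>: "\<mu> = (i, j)" by fastforce
    show ?case
    proof (cases "\<mu> \<in> D")
      case True
      have "mon \<mu> z = (\<Sum>\<delta>\<in>D. of_bool (\<delta> = \<mu>) * mon \<delta> z)" for z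
      proof -
        have "(\<Sum>\<delta>\<in>D. of_bool (\<delta> = \<mu>) * mon \<delta> z) = (\<Sum>\<delta>\<in>D. if \<delta> = \<mu> then mon \<mu> z else 0)"
          by (intro sum.cong) auto
        then show ?thesis using True assms(1) by simp
      qed
      then show ?thesis
        unfolding R_def by (intro CollectI exI[of _ "\<lambda>\<delta>. of_bool (\<delta> = \<mu>)"] ballI)
    next
      case False
      have "(\<lambda>(x, y). x ^ k * y ^ l) \<in> R" if "k + l < i + j \<or> k + l = i + j \<and> k < i" for k l
        using 1[of "(k, l)"] that by (simp add: mon_def \<mu>)
      then show ?thesis
        using reducible[of i j R] False R by (simp add: mon_def \<mu>)
    qed
  qed
  \<comment> \<open>Coefficient vectors indexed by \<open>D\<close> map onto the functions on
    \<open>Z\<close>, so \<open>q ^ card Z \<le> q ^ card D\<close>.\<close>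
  define \<Phi> where "\<Phi> c = (\<lambda>z\<in>Z. \<Sum>\<delta>\<in>D. c \<delta> * mon \<delta> z)" for c
  have "Z \<rightarrow>\<^sub>E UNIV \<subseteq> \<Phi> ` (D \<rightarrow>\<^sub>E UNIV)"
  proof
    fix g :: "'a \<times> 'a \<Rightarrow> 'a" assume g: "g \<in> Z \<rightarrow>\<^sub>E UNIV"
    have "g \<in> R"
    proof (rule all_functions_in_span_of_monomials[OF R])
      show "(\<lambda>(x, y). x ^ i * y ^ j) \<in> R" for i j
        using mon_R[of "(i, j)"] by (simp add: mon_def)
    qed
    then obtain c where c: "\<forall>z\<in>Z. g z = (\<Sum>\<delta>\<in>D. c \<delta> * mon \<delta> z)"
      unfolding R_def by blast
    have "g = \<Phi> (restrict c D)"
    proof (rule PiE_ext[OF g])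
      show "\<Phi> (restrict c D) \<in> Z \<rightarrow>\<^sub>E UNIV" by (simp add: \<Phi>_def)
      show "g z = \<Phi> (restrict c D) z" if "z \<in> Z" for z
        using c that by (simp add: \<Phi>_def)
    qed
    moreover have "restrict c D \<in> D \<rightarrow>\<^sub>E UNIV" by simp
    ultimately show "g \<in> \<Phi> ` (D \<rightarrow>\<^sub>E UNIV)" by (simp only: imageI)
  qed
  then have "card (Z \<rightarrow>\<^sub>E (UNIV :: 'a set)) \<le> card (D \<rightarrow>\<^sub>E (UNIV :: 'a set))"
    by (rule surj_card_le[rotated]) (use assms(1) in \<open>auto intro: finite_PiE\<close>)
  then have "CARD('a) ^ card Z \<le> CARD('a) ^ card D"
    using assms(1) by (simp add: card_PiE)
  then show ?thesis
    using card_field_ge_2[where 'a='a] by (simp add: power_increasing_iff)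
qed

section \<open>Homogenization, and reduction modulo a polynomial without roots\<close>

definition homogenize :: "nat \<Rightarrow> 'a::field poly \<Rightarrow> 'a \<Rightarrow> 'a \<Rightarrow> 'a" where
  "homogenize n P x y = (\<Sum>i\<le>n. coeff P i * x ^ i * y ^ (n - i))"

lemma homogenize_nonzero:
  assumes "degree P \<le> n" "y \<noteq> 0"
  shows "homogenize n P x y = y ^ n * poly P (x / y)"
proof -
  have "poly P (x / y) = (\<Sum>i\<le>n. coeff P i * (x / y) ^ i)"
    unfolding poly_altdef using assms(1)
    by (intro sum.mono_neutral_left) (auto simp: coeff_eq_0)
  then have "y ^ n * poly P (x / y) = (\<Sum>i\<le>n. y ^ n * (coeff P i * (x / y) ^ i))"
    by (simp add: sum_distrib_left)
  also have "\<dots> = homogenize n P x y"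
    unfolding homogenize_def using assms(2)
    by (intro sum.cong) (auto simp: power_divide power_diff)
  finally show ?thesis by simp
qed

lemma homogenize_zero: "homogenize n P x 0 = coeff P n * x ^ n"
proof -
  have "homogenize n P x 0 = (\<Sum>i\<le>n. if i = n then coeff P n * x ^ n else 0)"
    unfolding homogenize_def by (intro sum.cong) auto
  then show ?thesis by simp
qed

text \<open>Off \<open>y = 0\<close> this is multiplicativity of \<open>poly\<close> at
  \<open>x / y\<close>. On \<open>y = 0\<close> only the coefficients at the formal degrees
  \<open>k\<close>, \<open>l\<close> and \<open>k + l\<close> enter, and these multiply even when
  they are zero.\<close>

lemma homogenize_mult:
  assumes "degree P \<le> k" "degree Q \<le> l"
  shows "homogenize (k + l) (P * Q) x y = homogenize k P x y * homogenize l Q x y"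
proof (cases "y = 0")
  case True
  have "coeff (P * Q) (k + l) = coeff P k * coeff Q l"
  proof -
    have "coeff (P * Q) (k + l) = (\<Sum>i\<le>k + l. if i = k then coeff P k * coeff Q l else 0)"
      unfolding coeff_mult using assms
      by (intro sum.cong) (auto simp: coeff_eq_0 not_le neq_iff)
    then show ?thesis by simp
  qed
  then show ?thesis
    by (simp add: True homogenize_zero power_add mult_ac)
next
  case False
  have "degree (P * Q) \<le> k + l"
    using degree_mult_le[of P Q] assms by linarith
  with False assms show ?thesis
    by (simp add: homogenize_nonzero power_add mult_ac)
qed

lemma homogenize_add: "homogenize n (P + Q) x y = homogenize n P x y + homogenize n Q x y"
  by (simp add: homogenize_def sum.distrib distrib_right)


lemma homogenize_sum_monom:
  assumes "\<And>s. s \<in> S \<Longrightarrow> f s \<le> n"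
  shows "homogenize n (\<Sum>s\<in>S. monom (c s) (f s)) x y = (\<Sum>s\<in>S. c s * x ^ f s * y ^ (n - f s))"
proof -
  have "homogenize n (\<Sum>s\<in>S. monom (c s) (f s)) x y =
    (\<Sum>i\<le>n. \<Sum>s\<in>S. if f s = i then c s * x ^ i * y ^ (n - i) else 0)"
    unfolding homogenize_def coeff_sum sum_distrib_right
    by (intro sum.cong) auto
  also have "\<dots> = (\<Sum>s\<in>S. c s * x ^ f s * y ^ (n - f s))"
    using assms by (subst sum.swap) (auto intro!: sum.cong)
  finally show ?thesis .
qed

text \<open>The prime \<open>x - c\<close> does not divide \<open>h\<close>, so it can be cancelled
  from the cofactor once for each factor, until \<open>h\<close> divides 1.\<close>

lemma no_root_dvd_linear_power:
  fixes h :: "'a::field poly"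
  assumes "poly h c \<noteq> 0" "h dvd [:- c, 1:] ^ n"
  shows "degree h = 0"
proof -
  have "h dvd 1"
    using assms(2)
  proof (induction n)
    case (Suc n)
    then have "h dvd [:- c, 1:] * [:- c, 1:] ^ n" by (simp only: power_Suc)
    then obtain k where k: "[:- c, 1:] * [:- c, 1:] ^ n = h * k" by (rule dvdE)
    from arg_cong[OF k, of "\<lambda>p. poly p c"] assms(1) have "poly k c = 0" by simp
    then have "[:- c, 1:] dvd k" by (subst (asm) poly_eq_0_iff_dvd)
    then obtain k' where "k = [:- c, 1:] * k'" by (rule dvdE)
    with k have "[:- c, 1:] * [:- c, 1:] ^ n = [:- c, 1:] * (h * k')" by (simp only: mult.left_commute)
    then have "[:- c, 1:] ^ n = h * k'"
      by (subst (asm) mult_cancel_left) simp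
    then have "h dvd [:- c, 1:] ^ n" by (rule dvdI)
    then show ?case by (rule Suc.IH)
  qed simp
  moreover from this have "h \<noteq> 0" by auto
  ultimately show ?thesis by (simp add: is_unit_iff_degree)
qed

text \<open>A constant remainder \<open>c\<close> would make \<open>h\<close> divide
  \<open>x ^ q - c = (x - c) ^ q\<close>, although \<open>c\<close> is not a root of
  \<open>h\<close>.\<close>

lemma power_card_mod_degree:
  fixes h :: "'a::{finite,field} poly"
  assumes "degree h \<ge> 1" "\<And>c. poly h c \<noteq> 0"
  shows "degree (monom 1 CARD('a) mod h) \<ge> 1"
proof (rule ccontr)
  assume "\<not> ?thesis"
  then have "degree (monom 1 CARD('a) mod h) = 0" by simp
  then obtain c where "monom 1 CARD('a) mod h = [:c:]"
    by (rule degree_eq_zeroE)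
  then have "h dvd monom 1 CARD('a) - [:c:]"
    using dvd_minus_mod[of h "monom 1 CARD('a)"] by (simp only:)
  then show False
    using no_root_dvd_linear_power[of h c "CARD('a)"] assms by (simp add: linear_power_card)
qed

text \<open>Let \<open>r\<close> be the remainder of \<open>x\<^sup>q\<close> modulo the dehomogenized top form and \<open>n\<close> its degree.  On the zero
  set, \<open>x\<^sup>q = x\<close> makes \<open>x\<^sup>n y\<^bsup>q - n\<^esup>\<close> a combination of smaller monomials, besides \<open>x\<^sup>e\<close> and \<open>y\<^sup>q\<close>.  Since
  \<open>1 \<le> n < e\<close>, this excludes \<open>(e - n) n \<ge> e - 1\<close> of the \<open>e q\<close> monomials below \<open>x\<^sup>e\<close> and \<open>y\<^sup>q\<close>.\<close>

lemma anisotropic_zeros_bound: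
  fixes C :: "'i \<Rightarrow> 'a::{finite,field}" and A B :: "'i \<Rightarrow> nat"
  assumes "finite S" and deg: "\<And>s. s \<in> S \<Longrightarrow> A s + B s \<le> e"
    and e: "1 \<le> e" "e \<le> CARD('a)"
    and lead: "(\<Sum>s\<in>{s\<in>S. A s = e}. C s) \<noteq> 0"
    and anisotropic: "\<And>t. (\<Sum>s\<in>{s\<in>S. A s + B s = e}. C s * t ^ A s) \<noteq> 0"
  shows "card {(x, y). (\<Sum>s\<in>S. C s * x ^ A s * y ^ B s) = 0} + (e - 1) \<le> e * CARD('a)"
proof -
  define q where "q = CARD('a)"
  have q: "q \<ge> 2" using card_field_ge_2[where 'a='a] by (simp add: q_def)
  define Z where "Z = {(x, y). (\<Sum>s\<in>S. C s * x ^ A s * y ^ B s) = 0}"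
  define S1 where "S1 = {s\<in>S. A s + B s = e}"
  have S1: "S1 \<subseteq> S" "finite S1" using assms(1) by (auto simp: S1_def)
  define h where "h = (\<Sum>s\<in>S1. monom (C s) (A s))"
  have poly_h: "poly h t \<noteq> 0" for t
    using anisotropic[of t] by (simp add: h_def poly_sum poly_monom S1_def)
  have "coeff h e = (\<Sum>s\<in>S1. if A s = e then C s else 0)"
    by (simp add: h_def coeff_sum)
  also have "\<dots> = (\<Sum>s\<in>{s\<in>S1. A s = e}. C s)"
    using S1 by (simp add: sum.inter_filter)
  also have "{s\<in>S1. A s = e} = {s\<in>S. A s = e}"
    using deg by (force simp: S1_def)
  finally have coeff_h: "coeff h e \<noteq> 0" using lead by simp
  have "degree h \<le> e"
    unfolding h_def using S1 deg
    by (intro degree_sum_le) (fastforce intro: order_trans[OF degree_monom_le] simp: S1_def)+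
  then have deg_h: "degree h = e"
    using coeff_h le_degree[of h e] by simp
  then have "h \<noteq> 0" using e by auto
  define Q r where "Q = monom 1 q div h" and "r = monom 1 q mod h"
  define n where "n = degree r"
  have n1: "n \<ge> 1"
    unfolding n_def r_def q_def using e deg_h poly_h by (intro power_card_mod_degree) auto
  then have "r \<noteq> 0" by (auto simp: n_def)
  then have ne: "n < e"
    using degree_mod_less'[OF \<open>h \<noteq> 0\<close>, of "monom 1 q"] deg_h by (simp add: n_def r_def)
  have Qr: "monom 1 q = Q * h + r" by (simp add: Q_def r_def)
  have deg_Q: "degree Q \<le> q - e"
  proof (cases "Q = 0")
    case False
    have "degree (Q * h) = degree (monom 1 q - r)" by (simp add: Qr)
    also have "\<dots> \<le> q"
      using ne e by (intro degree_diff_le degree_monom_le) (auto simp: q_def n_def)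
    finally show ?thesis using False \<open>h \<noteq> 0\<close> by (simp add: degree_mult_eq deg_h)
  qed simp
  have hom_h: "homogenize e h x y = (\<Sum>s\<in>S1. C s * x ^ A s * y ^ B s)" for x y
  proof -
    have "homogenize e h x y = (\<Sum>s\<in>S1. C s * x ^ A s * y ^ (e - A s))"
      unfolding h_def by (rule homogenize_sum_monom) (auto simp: S1_def)
    then show ?thesis by (auto simp: S1_def intro!: sum.cong)
  qed
  have hom_r: "homogenize q r x y = coeff r n * (x ^ n * y ^ (q - n)) +
      (\<Sum>i<n. coeff r i * (x ^ i * y ^ (q - i)))" for x y
  proof -
    have "homogenize q r x y = (\<Sum>i\<le>n. coeff r i * x ^ i * y ^ (q - i))"
      unfolding homogenize_def using ne e
      by (intro sum.mono_neutral_right) (auto simp: coeff_eq_0 n_def q_def)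
    also have "{..n} = insert n {..<n}" by auto
    finally show ?thesis by (simp add: mult.assoc)
  qed
  \<comment> \<open>Homogenized to degree \<open>q\<close>, the division by \<open>h\<close>
    expresses \<open>x ^ q\<close> through the top form of the equation and the remainder.\<close>
  have power_q: "x ^ q = homogenize (q - e) Q x y * homogenize e h x y + homogenize q r x y" for x y
  proof -
    have "homogenize q (monom 1 q) x y = x ^ q"
      using homogenize_sum_monom[of "{0::nat}" "\<lambda>_. q" q "\<lambda>_. 1"] by simp
    moreover have "homogenize (q - e + e) (Q * h) x y = homogenize (q - e) Q x y * homogenize e h x y"
      by (rule homogenize_mult) (use deg_Q deg_h in auto)
    moreover have "homogenize q (monom 1 q) x y = homogenize q (Q * h) x y + homogenize q r x y"
      by (subst Qr) (rule homogenize_add)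
    ultimately show ?thesis
      using e by (simp add: q_def)
  qed
  \<comment> \<open>The monomials below \<open>x ^ e\<close> and \<open>y ^ q\<close> that are not
    divisible by \<open>x ^ n * y ^ (q - n)\<close>.\<close>
  define D where "D = {..<e} \<times> {..<q} - {n..<e} \<times> {q - n..<q}"
  have "card Z \<le> card D"
  proof (rule card_le_card_standard_monomials)
    show "finite D" by (simp add: D_def)
  next
    fix i j R
    assume ij: "(i, j) \<notin> D" and R: "subspace_on Z R" and
      smaller: "\<And>k l. k + l < i + j \<or> k + l = i + j \<and> k < i \<Longrightarrow> (\<lambda>(x, y). x ^ k * y ^ l) \<in> R"
    note closed = subspace_on_sum[OF R] subspace_onD(3)[OF R] subspace_onD(2)[OF R] subspace_on_diff[OF R]
    consider "i \<ge> e" | "j \<ge> q" | "n \<le> i" "q - n \<le> j"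
      using ij by (force simp: D_def)
    then show "(\<lambda>(x, y). x ^ i * y ^ j) \<in> R"
    proof cases
      case 1
      \<comment> \<open>The equation of \<open>Z\<close> is solved for \<open>x ^ e\<close>. Terms
        with \<open>A s = e\<close> have \<open>B s = 0\<close> by the degree bound; every other
        term has lower degree, or the same degree and a lower power of \<open>x\<close>.\<close>
      define c where "c = (\<Sum>s\<in>{s\<in>S. A s = e}. C s)"
      have "(\<lambda>z. - 1 / c * (\<Sum>s\<in>{s\<in>S. A s \<noteq> e}. C s * (case z of (x, y) \<Rightarrow> x ^ (A s + (i - e)) * y ^ (B s + j)))) \<in> R"
        using 1 deg by (intro closed smaller) fastforce
      then show ?thesis
      proof (rule subspace_onD(4)[OF R], clarify)
        fix x y assume "(x, y) \<in> Z"
        then have "0 = (\<Sum>s\<in>S. C s * x ^ A s * y ^ B s)" by (simp add: Z_def)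
        also have "\<dots> = (\<Sum>s\<in>{s\<in>S. A s = e} \<union> {s\<in>S. A s \<noteq> e}. C s * x ^ A s * y ^ B s)"
          by (intro sum.cong) auto
        also have "\<dots> = (\<Sum>s\<in>{s\<in>S. A s = e}. C s * x ^ A s * y ^ B s) + (\<Sum>s\<in>{s\<in>S. A s \<noteq> e}. C s * x ^ A s * y ^ B s)"
          using assms(1) by (intro sum.union_disjoint) auto
        also have "(\<Sum>s\<in>{s\<in>S. A s = e}. C s * x ^ A s * y ^ B s) = c * x ^ e"
          unfolding c_def sum_distrib_right using deg by (intro sum.cong) force+
        finally have eq: "c * x ^ e = - (\<Sum>s\<in>{s\<in>S. A s \<noteq> e}. C s * x ^ A s * y ^ B s)"
          by (simp add: eq_neg_iff_add_eq_0)
        have "x ^ i * y ^ j = (x ^ e) * (x ^ (i - e) * y ^ j)"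
          using 1 by (simp flip: power_add mult.assoc)
        also have "x ^ e = - 1 / c * (\<Sum>s\<in>{s\<in>S. A s \<noteq> e}. C s * x ^ A s * y ^ B s)"
          using eq lead by (simp add: c_def field_simps)
        finally have "x ^ i * y ^ j = - 1 / c * ((\<Sum>s\<in>{s\<in>S. A s \<noteq> e}. C s * x ^ A s * y ^ B s) * (x ^ (i - e) * y ^ j))"
          by (simp only: mult.assoc)
        also have "(\<Sum>s\<in>{s\<in>S. A s \<noteq> e}. C s * x ^ A s * y ^ B s) * (x ^ (i - e) * y ^ j) =
            (\<Sum>s\<in>{s\<in>S. A s \<noteq> e}. C s * (x ^ (A s + (i - e)) * y ^ (B s + j)))"
          unfolding sum_distrib_right by (simp add: power_add mult_ac)
        finally show "- 1 / c * (\<Sum>s\<in>{s\<in>S. A s \<noteq> e}. C s * (x ^ (A s + (i - e)) * y ^ (B s + j))) = x ^ i * y ^ j"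
          by (rule sym)
      qed
    next
      case 2
      \<comment> \<open>Here \<open>y ^ q = y\<close> lowers the total degree, because
        \<open>q \<ge> 2\<close>.\<close>
      have "(\<lambda>(x, y). x ^ i * y ^ (j - q + 1)) \<in> R"
        using 2 q by (intro smaller) auto
      moreover have "y ^ j = y ^ (j - q + 1)" for y :: 'a
      proof -
        have "y ^ j = y ^ (j - q) * y ^ q" using 2 by (simp flip: power_add)
        then show ?thesis using finite_field_power_card[of y] by (simp add: q_def)
      qed
      ultimately show ?thesis by simp
    next
      case 3
      \<comment> \<open>The relation for \<open>x ^ n * y ^ (q - n)\<close> is multiplied by
        \<open>x ^ a * y ^ b\<close>. On \<open>Z\<close> the top form equals minus the terms of
        degree below \<open>e\<close>, so its product with \<open>Q\<close> drops in degree, and so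
        does \<open>x ^ q = x\<close>. The remaining terms of \<open>r\<close> keep the degree but
        have a lower power of \<open>x\<close>.\<close>
      define a b where "a = i - n" and "b = j - (q - n)"
      have ab: "i = n + a" "j = q - n + b" using 3 by (auto simp: a_def b_def)
      have nq: "n < q" using ne e by (simp add: q_def)
      let ?S2 = "{s\<in>S. A s + B s < e}"
      have "(\<lambda>z. 1 / coeff r n * ((case z of (x, y) \<Rightarrow> x ^ (a + 1) * y ^ b) +
          (\<Sum>l\<le>q - e. \<Sum>s\<in>?S2. coeff Q l * C s * (case z of (x, y) \<Rightarrow> x ^ (l + A s + a) * y ^ (q - e - l + B s + b)))
          - (\<Sum>l<n. coeff r l * (case z of (x, y) \<Rightarrow> x ^ (l + a) * y ^ (q - l + b))))) \<in> R"
        using q nq e deg by (intro closed smaller) (auto simp: ab q_def)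
      then show ?thesis
      proof (rule subspace_onD(4)[OF R], clarify)
        fix x y assume "(x, y) \<in> Z"
        then have "0 = (\<Sum>s\<in>S. C s * x ^ A s * y ^ B s)" by (simp add: Z_def)
        also have "\<dots> = (\<Sum>s\<in>S1 \<union> ?S2. C s * x ^ A s * y ^ B s)"
          using deg by (intro sum.cong) (force simp: S1_def)+
        also have "\<dots> = homogenize e h x y + (\<Sum>s\<in>?S2. C s * x ^ A s * y ^ B s)"
          unfolding hom_h using assms(1) by (intro sum.union_disjoint) (auto simp: S1_def)
        finally have eq: "homogenize e h x y = - (\<Sum>s\<in>?S2. C s * x ^ A s * y ^ B s)"
          by (simp add: eq_neg_iff_add_eq_0)
        have "x = x ^ q"
          using finite_field_power_card[of x] by (simp add: q_def)
        then have "coeff r n * (x ^ n * y ^ (q - n)) = x + homogenize (q - e) Q x y * (\<Sum>s\<in>?S2. C s * x ^ A s * y ^ B s)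
          - (\<Sum>i<n. coeff r i * (x ^ i * y ^ (q - i)))"
          using power_q[of x y] unfolding eq hom_r by (simp add: algebra_simps)
        then have "coeff r n * (x ^ n * y ^ (q - n)) * (x ^ a * y ^ b) = (x + homogenize (q - e) Q x y * (\<Sum>s\<in>?S2. C s * x ^ A s * y ^ B s)
          - (\<Sum>i<n. coeff r i * (x ^ i * y ^ (q - i)))) * (x ^ a * y ^ b)" by simp
        also have "\<dots> = x ^ (a + 1) * y ^ b +
          (\<Sum>l\<le>q - e. \<Sum>s\<in>?S2. coeff Q l * C s * (x ^ (l + A s + a) * y ^ (q - e - l + B s + b)))
          - (\<Sum>l<n. coeff r l * (x ^ (l + a) * y ^ (q - l + b)))" (is "_ = ?rhs")
          unfolding homogenize_def sum_product unfolding left_diff_distrib distrib_right sum_distrib_right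
          by (simp add: power_add mult_ac)
        finally have "coeff r n * (x ^ n * y ^ (q - n)) * (x ^ a * y ^ b) = ?rhs" .
        moreover have "coeff r n \<noteq> 0" using \<open>r \<noteq> 0\<close> by (simp add: n_def)
        ultimately show "1 / coeff r n * ?rhs = x ^ i * y ^ j"
          by (simp add: ab power_add field_simps)
      qed
    qed
  qed
  moreover have "card D = e * q - (e - n) * n"
    unfolding D_def using ne e by (subst card_Diff_subset) (auto simp: q_def)
  \<comment> \<open>For \<open>n = u + 1\<close> and \<open>e - n = v + 1\<close> the product
    exceeds \<open>e - 1\<close> by \<open>u * v\<close>.\<close>
  moreover have "e - 1 \<le> (e - n) * n"
  proof -
    obtain u v where "n = Suc u" "e - n = Suc v"
      using n1 ne by (cases n; cases "e - n") auto
    then show ?thesis by simp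
  qed
  moreover have "(e - n) * n \<le> e * q"
    using ne e by (intro mult_le_mono) (auto simp: q_def)
  ultimately show ?thesis
    unfolding Z_def q_def by linarith
qed

section \<open>Leading monomials\<close>

lemma card_nonzero_PiE_insert:
  fixes F :: "('i \<Rightarrow> 'a::finite) \<Rightarrow> 'b::zero"
  assumes "finite I" "i \<notin> I"
  shows "card {x \<in> insert i I \<rightarrow>\<^sub>E UNIV. F x \<noteq> 0} =
    (\<Sum>x\<in>I \<rightarrow>\<^sub>E UNIV. card {a. F (x(i := a)) \<noteq> 0})"
proof -
  have fin: "finite (I \<rightarrow>\<^sub>E (UNIV :: 'a set))" using assms(1) by (intro finite_PiE) auto
  have "bij_betw (\<lambda>(x, a). x(i := a)) (SIGMA x:I \<rightarrow>\<^sub>E UNIV. {a. F (x(i := a)) \<noteq> 0})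
      {x \<in> insert i I \<rightarrow>\<^sub>E UNIV. F x \<noteq> 0}"
  proof (rule bij_betwI[where g = "\<lambda>x. (restrict x I, x i)"])
    show "(\<lambda>x. (restrict x I, x i)) \<in> {x \<in> insert i I \<rightarrow>\<^sub>E UNIV. F x \<noteq> 0} \<rightarrow>
      (SIGMA x:I \<rightarrow>\<^sub>E UNIV. {a. F (x(i := a)) \<noteq> 0})"
    proof (clarsimp)
      fix x :: "'i \<Rightarrow> 'a" assume x: "x \<in> insert i I \<rightarrow>\<^sub>E UNIV" "F x \<noteq> 0" and z: "F ((restrict x I)(i := x i)) = 0"
      have "(restrict x I)(i := x i) = x"
        using x(1) assms(2) by (auto simp: fun_eq_iff PiE_def extensional_def)
      with x(2) z show False by simp
    qed
  qed (use assms(2) in \<open>auto simp: fun_eq_iff PiE_def extensional_def\<close>)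
  then have "card {x \<in> insert i I \<rightarrow>\<^sub>E UNIV. F x \<noteq> 0} =
      card (SIGMA x:I \<rightarrow>\<^sub>E UNIV. {a. F (x(i := a)) \<noteq> 0})"
    by (simp add: bij_betw_same_card)
  then show ?thesis
    using fin by simp
qed


text \<open>The same double count, sliced by the value of coordinate \<open>i\<close> instead of
  fibred into lines in direction \<open>i\<close>.\<close>

lemma card_nonzero_PiE_insert_slices:
  fixes F :: "('i \<Rightarrow> 'a::finite) \<Rightarrow> 'b::zero"
  assumes "finite I" "i \<notin> I"
  shows "card {x \<in> insert i I \<rightarrow>\<^sub>E UNIV. F x \<noteq> 0} =
    (\<Sum>a\<in>UNIV. card {x \<in> I \<rightarrow>\<^sub>E UNIV. F (x(i := a)) \<noteq> 0})"
proof -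
  have fin: "finite (I \<rightarrow>\<^sub>E (UNIV :: 'a set))" using assms(1) by (intro finite_PiE) auto
  have "card {x \<in> insert i I \<rightarrow>\<^sub>E UNIV. F x \<noteq> 0} =
      (\<Sum>x\<in>I \<rightarrow>\<^sub>E UNIV. \<Sum>a\<in>UNIV. of_bool (F (x(i := a)) \<noteq> 0))"
    unfolding card_nonzero_PiE_insert[OF assms] by simp
  also have "\<dots> = (\<Sum>a\<in>UNIV. \<Sum>x\<in>I \<rightarrow>\<^sub>E UNIV. of_bool (F (x(i := a)) \<noteq> 0))"
    by (rule sum.swap)
  also have "\<dots> = (\<Sum>a\<in>UNIV. card {x \<in> I \<rightarrow>\<^sub>E UNIV. F (x(i := a)) \<noteq> 0})"
    using fin by (intro sum.cong) (auto simp: Int_def)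
  finally show ?thesis .
qed

lemma card_PiE_nonzero:
  assumes "finite I" "i \<in> I"
  shows "card {x \<in> I \<rightarrow>\<^sub>E (UNIV :: 'a::{finite,zero} set). x i \<noteq> 0} = (CARD('a) - 1) * CARD('a) ^ (card I - 1)"
proof -
  have "{a :: 'a. a \<noteq> 0} = UNIV - {0}" by auto
  then have "card {a :: 'a. a \<noteq> 0} = CARD('a) - 1" by (simp add: card_Diff_singleton)
  then show ?thesis
    using card_nonzero_PiE_insert[of "I - {i}" i "\<lambda>x. x i :: 'a"] assms
    by (simp add: insert_absorb card_PiE)
qed

text \<open>Induction over the variables in the order \<open>js\<close>: only the monomials of
  maximal exponent \<open>M\<close> in the first variable are kept, and their sum is the coefficient
  of its \<open>M\<close>-th power. Injectivity keeps the surviving monomials distinct. The monomial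
  \<open>\<mu>\<close> is thus the lexicographic leader, so if it avoids an initial block of
  variables, all monomials do.\<close>

lemma lex_leading_monomial_nonzeros:
  fixes C :: "'s \<Rightarrow> 'a::{finite,field}" and E :: "'s \<Rightarrow> 'i \<Rightarrow> nat"
  assumes "distinct js" "finite S" "S \<noteq> {}" "\<And>s. s \<in> S \<Longrightarrow> C s \<noteq> 0"
    and "inj_on (\<lambda>s. restrict (E s) (set js)) S"
  shows "\<exists>\<mu>\<in>S. (\<Prod>i\<in>set js. CARD('a) - E \<mu> i) \<le>
      card {x \<in> set js \<rightarrow>\<^sub>E UNIV. (\<Sum>s\<in>S. C s * (\<Prod>i\<in>set js. x i ^ E s i)) \<noteq> 0} \<and>
    (\<forall>n. (\<forall>i\<in>set (take n js). E \<mu> i = 0) \<longrightarrow> (\<forall>s\<in>S. \<forall>i\<in>set (take n js). E s i = 0))"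
  using assms
proof (induction js arbitrary: S)
  case Nil
  obtain \<mu> where \<mu>: "\<mu> \<in> S" using Nil.prems(3) by blast
  have "s = \<mu>" if "s \<in> S" for s
    using Nil.prems(5) that \<mu> by (auto simp: inj_on_def)
  then have S: "S = {\<mu>}" using \<mu> by blast
  show ?case
    using Nil.prems(4)[OF \<mu>] by (auto simp: S)
next
  case (Cons j js)
  define M where "M = Max ((\<lambda>s. E s j) ` S)"
  define S' where "S' = {s\<in>S. E s j = M}"
  have le_M: "E s j \<le> M" if "s \<in> S" for s
    unfolding M_def using that Cons.prems(2) by (intro Max_ge) auto
  have "M \<in> (\<lambda>s. E s j) ` S"
    unfolding M_def using Cons.prems(2,3) by (intro Max_in) auto
  then have S'_ne: "S' \<noteq> {}" by (auto simp: S'_def)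
  have inj: "inj_on (\<lambda>s. restrict (E s) (set js)) S'"
  proof (rule inj_onI)
    fix s t assume st: "s \<in> S'" "t \<in> S'" and eq: "restrict (E s) (set js) = restrict (E t) (set js)"
    have "E s i = E t i" if "i \<in> set js" for i
      using fun_cong[OF eq, of i] that by simp
    then have "restrict (E s) (set (j # js)) = restrict (E t) (set (j # js))"
      using st by (auto simp: fun_eq_iff S'_def)
    with Cons.prems(5) show "s = t"
      by (rule inj_onD) (use st in \<open>auto simp: S'_def\<close>)
  qed
  have "\<exists>\<mu>\<in>S'. (\<Prod>i\<in>set js. CARD('a) - E \<mu> i) \<le>
      card {x \<in> set js \<rightarrow>\<^sub>E UNIV. (\<Sum>s\<in>S'. C s * (\<Prod>i\<in>set js. x i ^ E s i)) \<noteq> 0} \<and>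
    (\<forall>n. (\<forall>i\<in>set (take n js). E \<mu> i = 0) \<longrightarrow> (\<forall>s\<in>S'. \<forall>i\<in>set (take n js). E s i = 0))"
  proof (rule Cons.IH[OF _ _ S'_ne _ inj])
    show "distinct js" "finite S'" using Cons.prems(1,2) by (auto simp: S'_def)
    show "C s \<noteq> 0" if "s \<in> S'" for s using Cons.prems(4) that by (simp add: S'_def)
  qed
  then obtain \<mu> where \<mu>: "\<mu> \<in> S'"
    and card_\<mu>: "(\<Prod>i\<in>set js. CARD('a) - E \<mu> i) \<le>
      card {x \<in> set js \<rightarrow>\<^sub>E UNIV. (\<Sum>s\<in>S'. C s * (\<Prod>i\<in>set js. x i ^ E s i)) \<noteq> 0}"
    and first_\<mu>: "\<And>n. (\<forall>i\<in>set (take n js). E \<mu> i = 0) \<Longrightarrow> (\<forall>s\<in>S'. \<forall>i\<in>set (take n js). E s i = 0)"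
    by blast
  have \<mu>j: "E \<mu> j = M" and \<mu>S: "\<mu> \<in> S" using \<mu> by (auto simp: S'_def)
  have j: "j \<notin> set js" using Cons.prems(1) by simp
  let ?F = "\<lambda>x. \<Sum>s\<in>S. C s * (\<Prod>i\<in>set (j # js). x i ^ E s i)"
  let ?G = "\<lambda>x. \<Sum>s\<in>S'. C s * (\<Prod>i\<in>set js. x i ^ E s i)"
  let ?X = "set js \<rightarrow>\<^sub>E (UNIV :: 'a set)"
  have finX: "finite ?X" by (intro finite_PiE) auto
  have slice: "CARD('a) - M \<le> card {a. ?F (x(j := a)) \<noteq> 0}" if "?G x \<noteq> 0" for x
  proof -
    \<comment> \<open>Restricted to the line through \<open>x\<close>, the sum is a polynomial in
      the variable \<open>j\<close> of degree \<open>M\<close> with leading coefficient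
      \<open>?G x\<close>, hence it has at most \<open>M\<close> roots.\<close>
    define P where "P = (\<Sum>s\<in>S. monom (C s * (\<Prod>i\<in>set js. x i ^ E s i)) (E s j))"
    have "coeff P M = (\<Sum>s\<in>S. if E s j = M then C s * (\<Prod>i\<in>set js. x i ^ E s i) else 0)"
      by (simp add: P_def coeff_sum)
    also have "\<dots> = ?G x"
      unfolding S'_def using Cons.prems(2) by (simp add: sum.inter_filter)
    finally have "P \<noteq> 0" using that by auto
    have "degree P \<le> M"
      unfolding P_def using le_M Cons.prems(2)
      by (intro degree_sum_le) (auto intro: order_trans[OF degree_monom_le])
    then have "card {a. poly P a = 0} \<le> M"
      using card_poly_roots_bound[OF \<open>P \<noteq> 0\<close>] by linarith
    moreover have "card {a. poly P a \<noteq> 0} = CARD('a) - card {a. poly P a = 0}"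
    proof -
      have "{a. poly P a \<noteq> 0} = UNIV - {a. poly P a = 0}" by auto
      then show ?thesis by (simp add: card_Diff_subset)
    qed
    moreover have "?F (x(j := a)) = poly P a" for a
    proof -
      have "(\<Prod>i\<in>set js. (x(j := a)) i ^ E s i) = (\<Prod>i\<in>set js. x i ^ E s i)" for s
        using j by (intro prod.cong) auto
      then show ?thesis
        using j by (simp add: P_def poly_sum poly_monom mult_ac)
    qed
    ultimately show ?thesis by simp
  qed
  have "(\<Prod>i\<in>set (j # js). CARD('a) - E \<mu> i) = (\<Prod>i\<in>set js. CARD('a) - E \<mu> i) * (CARD('a) - M)"
    using j by (simp add: \<mu>j)
  also have "\<dots> \<le> card {x \<in> ?X. ?G x \<noteq> 0} * (CARD('a) - M)"
    using card_\<mu> by (rule mult_le_mono1)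
  also have "\<dots> = (\<Sum>x\<in>{x \<in> ?X. ?G x \<noteq> 0}. CARD('a) - M)" by simp
  also have "\<dots> \<le> (\<Sum>x\<in>{x \<in> ?X. ?G x \<noteq> 0}. card {a. ?F (x(j := a)) \<noteq> 0})"
    using slice by (intro sum_mono) blast
  also have "\<dots> \<le> (\<Sum>x\<in>?X. card {a. ?F (x(j := a)) \<noteq> 0})"
    using finX by (intro sum_mono2) auto
  also have "\<dots> = card {x \<in> insert j (set js) \<rightarrow>\<^sub>E UNIV. ?F x \<noteq> 0}"
    by (rule card_nonzero_PiE_insert[symmetric]) (use j in auto)
  finally have "(\<Prod>i\<in>set (j # js). CARD('a) - E \<mu> i) \<le>
      card {x \<in> set (j # js) \<rightarrow>\<^sub>E UNIV. ?F x \<noteq> 0}" by simp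
  moreover have "\<forall>s\<in>S. \<forall>i\<in>set (take n (j # js)). E s i = 0"
    if "\<forall>i\<in>set (take n (j # js)). E \<mu> i = 0" for n
  proof (cases n)
    case (Suc k)
    \<comment> \<open>A vanishing first exponent of \<open>\<mu>\<close> means \<open>M = 0\<close>;
      then no monomial was discarded, and the induction hypothesis speaks about all of
      \<open>S\<close>.\<close>
    with that have "M = 0" "\<forall>i\<in>set (take k js). E \<mu> i = 0" by (auto simp: \<mu>j)
    moreover from this(1) have "S' = S" using le_M by (auto simp: S'_def)
    ultimately show ?thesis
      using first_\<mu>[of k] Suc le_M by auto
  qed simp
  ultimately show ?case using \<mu>S by blast
qed

text \<open>The product is least when the whole exponent \<open>s\<close> sits on one variable, as
  \<open>(q - a) (q - b) \<ge> q (q - a - b)\<close>. The factor \<open>q\<close> on the right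
  avoids the exponent \<open>card I - 1\<close>.\<close>

lemma prod_diff_ge:
  fixes q :: nat
  assumes "finite I" "(\<Sum>i\<in>I. f i) \<le> s"
  shows "(q - s) * q ^ card I \<le> q * (\<Prod>i\<in>I. q - f i)"
  using assms
proof (induction I arbitrary: s rule: finite_induct)
  case (insert i I)
  have "(q - s) * q ^ card (insert i I) = (q - s) * q * q ^ card I"
    using insert.hyps by simp
  also have "\<dots> \<le> ((q - f i) * (q - (s - f i))) * q ^ card I"
  proof (rule mult_le_mono1)
    \<comment> \<open>If \<open>s \<le> q\<close>, the difference of the sides is
      \<open>f i * (s - f i)\<close>; otherwise the left side is 0 by truncated subtraction.\<close>
    show "(q - s) * q \<le> (q - f i) * (q - (s - f i))"
    proof (cases "s \<le> q")
      case True
      have fs: "f i \<le> s" using insert by simp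
      obtain u where u: "q = s + u" using True le_Suc_ex by blast
      obtain v where v: "s = f i + v" using fs le_Suc_ex by blast
      show ?thesis by (simp add: u v algebra_simps)
    qed simp
  qed
  also have "\<dots> = (q - f i) * ((q - (s - f i)) * q ^ card I)" by (simp only: mult.assoc)
  also have "\<dots> \<le> (q - f i) * (q * (\<Prod>i\<in>I. q - f i))"
    using insert by (intro mult_le_mono2 insert.IH) auto
  also have "\<dots> = q * (\<Prod>i\<in>insert i I. q - f i)"
    using insert.hyps by simp
  finally show ?case .
qed simp

text \<open>\<open>(q - a) (q - (k + 1 - a))\<close> is minimal at the ends of the range \<open>1 \<le> a \<le> k\<close>.\<close>

lemma prod_diff_ge_mixed:
  fixes q :: nat
  assumes "finite I" "(\<Sum>i\<in>I. f i) \<le> Suc k" "k < q" "i \<in> I" "1 \<le> f i" "f i \<le> k"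
  shows "(q - 1) * (q - k) * q ^ card I \<le> q ^ 2 * (\<Prod>i\<in>I. q - f i)"
proof -
  obtain n where n: "card I = Suc n" using assms(1,4) by (cases "card I") auto
  have cardI: "card (I - {i}) = n" using n assms(1,4) by simp
  have "(\<Sum>j\<in>I. f j) = f i + (\<Sum>j\<in>I - {i}. f j)"
    using assms(1,4) by (rule sum.remove)
  with assms(2) have "(\<Sum>j\<in>I - {i}. f j) \<le> Suc k - f i" by simp
  then have le: "(q - (Suc k - f i)) * q ^ n \<le> q * (\<Prod>j\<in>I - {i}. q - f j)"
    using prod_diff_ge[of "I - {i}" f "Suc k - f i" q] assms(1) cardI by simp
  obtain u v w where uvw: "f i = Suc u" "k = f i + v" "q = Suc k + w"
    using assms(3,5,6) by (metis Suc_le_D One_nat_def le_Suc_ex Suc_leI)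
  \<comment> \<open>The difference of the sides is \<open>u * v\<close>.\<close>
  have "(q - 1) * (q - k) \<le> (q - f i) * (q - (Suc k - f i))"
    by (simp add: uvw algebra_simps)
  then have "(q - 1) * (q - k) * q ^ card I \<le> (q - f i) * (q - (Suc k - f i)) * q ^ card I"
    by (rule mult_le_mono1)
  also have "\<dots> = (q - f i) * q * ((q - (Suc k - f i)) * q ^ n)" by (simp add: n)
  also have "\<dots> \<le> (q - f i) * q * (q * (\<Prod>j\<in>I - {i}. q - f j))"
    using le by (rule mult_le_mono2)
  also have "\<dots> = q ^ 2 * (\<Prod>j\<in>I. q - f j)"
    using prod.remove[OF assms(1,4), of "\<lambda>j. q - f j"] by (simp add: power2_eq_square)
  finally show ?thesis .
qed

section \<open>Evaluation and substitution\<close>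

text \<open>Evaluation inside the coefficient ring. For coordinates in the base field it agrees with
  \<open>eval_ac\<close> up to the embedding \<open>to_ac\<close>.\<close>

definition meval :: "nat \<Rightarrow> 'a::comm_semiring_1 mpoly \<Rightarrow> (nat \<Rightarrow> 'a) \<Rightarrow> 'a" where
  "meval m f x = (\<Sum>a\<in>Poly_Mapping.keys f.
     Poly_Mapping.lookup f a * (\<Prod>i\<le>m. x i ^ Poly_Mapping.lookup a i))"

lemma eval_ac_to_ac: "eval_ac m f (\<lambda>i. to_ac (x i)) = to_ac (meval m f x)"
  by (simp add: eval_ac_def meval_def to_ac_sum to_ac_prod)

lemma meval_cong: "(\<And>i. i \<le> m \<Longrightarrow> x i = y i) \<Longrightarrow> meval m f x = meval m f y"
  unfolding meval_def by (intro sum.cong prod.cong arg_cong2[of _ _ _ _ "(*)"]) auto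

lemma meval_superset:
  assumes "finite A" "Poly_Mapping.keys f \<subseteq> A"
  shows "meval m f x = (\<Sum>a\<in>A. Poly_Mapping.lookup f a * (\<Prod>i\<le>m. x i ^ Poly_Mapping.lookup a i))"
  unfolding meval_def using assms
  by (intro sum.mono_neutral_left) (auto simp: in_keys_iff)

lemma meval_zero [simp]: "meval m 0 x = 0"
  by (simp add: meval_def)

lemma meval_add: "meval m (f + g) x = meval m f x + meval m g x"
proof -
  let ?A = "Poly_Mapping.keys f \<union> Poly_Mapping.keys g"
  have "meval m (f + g) x = (\<Sum>a\<in>?A. Poly_Mapping.lookup (f + g) a * (\<Prod>i\<le>m. x i ^ Poly_Mapping.lookup a i))"
    using keys_add[of f g] by (intro meval_superset) auto
  also have "\<dots> = meval m f x + meval m g x"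
    by (subst (1 2) meval_superset[of ?A]) (auto simp: lookup_add distrib_right sum.distrib)
  finally show ?thesis .
qed

lemma meval_sum: "meval m (\<Sum>i\<in>I. f i) x = (\<Sum>i\<in>I. meval m (f i) x)"
  by (induction I rule: infinite_finite_induct) (auto simp: meval_add)

lemma meval_single:
  "meval m (Poly_Mapping.single a c) x = c * (\<Prod>i\<le>m. x i ^ Poly_Mapping.lookup a i)"
  by (subst meval_superset[of "{a}"]) auto

lemma poly_mapping_sum_single:
  "f = (\<Sum>a\<in>Poly_Mapping.keys f. Poly_Mapping.single a (Poly_Mapping.lookup f a))"
  by (rule poly_mapping_eqI) (auto simp: lookup_sum lookup_single when_def in_keys_iff)

lemma meval_mult: "meval m (f * g) x = meval m f x * meval m g x"
proof -
  have "f * g = (\<Sum>a\<in>Poly_Mapping.keys f. Poly_Mapping.single a (Poly_Mapping.lookup f a)) *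
      (\<Sum>b\<in>Poly_Mapping.keys g. Poly_Mapping.single b (Poly_Mapping.lookup g b))"
    using poly_mapping_sum_single[of f] poly_mapping_sum_single[of g] by simp
  then have "meval m (f * g) x = (\<Sum>a\<in>Poly_Mapping.keys f. \<Sum>b\<in>Poly_Mapping.keys g.
      (Poly_Mapping.lookup f a * (\<Prod>i\<le>m. x i ^ Poly_Mapping.lookup a i)) *
      (Poly_Mapping.lookup g b * (\<Prod>i\<le>m. x i ^ Poly_Mapping.lookup b i)))"
    by (simp add: sum_product mult_single meval_sum meval_single lookup_add power_add
        prod.distrib mult_ac)
  then show ?thesis
    by (simp add: meval_def sum_product)
qed

lemma meval_one [simp]: "meval m 1 x = 1"
  using meval_single[of m 0 1 x] by simp

lemma meval_power: "meval m (f ^ n) x = meval m f x ^ n"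
  by (induction n) (auto simp: meval_mult)

lemma meval_prod: "meval m (\<Prod>i\<in>I. f i) x = (\<Prod>i\<in>I. meval m (f i) x)"
  by (induction I rule: infinite_finite_induct) (auto simp: meval_mult)

definition mvar :: "nat \<Rightarrow> 'a::comm_semiring_1 mpoly" where
  "mvar i = Poly_Mapping.single (Poly_Mapping.single i 1) 1"

lemma prod_power_lookup_single:
  fixes x :: "nat \<Rightarrow> 'a::comm_semiring_1"
  assumes "j \<le> m"
  shows "(\<Prod>i\<le>m. x i ^ Poly_Mapping.lookup (Poly_Mapping.single j n) i) = x j ^ n"
proof -
  have "(\<Prod>i\<le>m. x i ^ Poly_Mapping.lookup (Poly_Mapping.single j n) i) = (\<Prod>i\<le>m. if i = j then x j ^ n else 1)"
    by (intro prod.cong) (auto simp: lookup_single when_def)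
  also have "\<dots> = x j ^ n" using assms by (subst prod.delta) auto
  finally show ?thesis .
qed

lemma meval_mvar [simp]: "i \<le> m \<Longrightarrow> meval m (mvar i) x = x i"
  using prod_power_lookup_single[of i m x 1] by (simp add: mvar_def meval_single)

definition msubst :: "nat \<Rightarrow> (nat \<Rightarrow> 'a mpoly) \<Rightarrow> 'a::comm_semiring_1 mpoly \<Rightarrow> 'a mpoly" where
  "msubst m \<sigma> f = (\<Sum>a\<in>Poly_Mapping.keys f.
     Poly_Mapping.single 0 (Poly_Mapping.lookup f a) * (\<Prod>i\<le>m. \<sigma> i ^ Poly_Mapping.lookup a i))"

lemma meval_msubst: "meval m (msubst m \<sigma> f) x = meval m f (\<lambda>i. meval m (\<sigma> i) x)"
  unfolding msubst_def meval_sum meval_mult meval_prod meval_power meval_single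
  by (simp add: meval_def)

lemma weighted_exponents_zero: "0 \<in> weighted_exponents m w 0"
  by (simp add: weighted_exponents_def)

lemma weighted_exponents_add:
  assumes "a \<in> weighted_exponents m w d" "b \<in> weighted_exponents m w e"
  shows "a + b \<in> weighted_exponents m w (d + e)"
  using assms keys_add[of a b]
  by (auto simp: weighted_exponents_def lookup_add distrib_left sum.distrib)

lemma weighted_exponents_single:
  assumes "i \<le> m"
  shows "Poly_Mapping.single i n \<in> weighted_exponents m w (w i * n)"
proof -
  have "(\<Sum>j\<le>m. w j * Poly_Mapping.lookup (Poly_Mapping.single i n) j) = (\<Sum>j\<le>m. if j = i then w i * n else 0)"
    by (intro sum.cong) (auto simp: lookup_single)
  then show ?thesis using assms by (auto simp: weighted_exponents_def split: if_splits)
qed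

lemma weighted_homogeneous_add:
  "f \<in> weighted_homogeneous m w d \<Longrightarrow> g \<in> weighted_homogeneous m w d \<Longrightarrow> f + g \<in> weighted_homogeneous m w d"
  unfolding weighted_homogeneous_def by (rule mpoly.span_add)

lemma weighted_homogeneous_sum:
  "(\<And>i. i \<in> I \<Longrightarrow> f i \<in> weighted_homogeneous m w d) \<Longrightarrow> (\<Sum>i\<in>I. f i) \<in> weighted_homogeneous m w d"
  unfolding weighted_homogeneous_def by (rule mpoly.span_sum)

lemma weighted_homogeneous_scale:
  "f \<in> weighted_homogeneous m w d \<Longrightarrow> Poly_Mapping.single 0 c * f \<in> weighted_homogeneous m w d"
  unfolding weighted_homogeneous_def mpoly_scale_def[symmetric] by (rule mpoly.span_scale)

lemma weighted_homogeneous_mult: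
  assumes "f \<in> weighted_homogeneous m w d" "g \<in> weighted_homogeneous m w e"
  shows "f * g \<in> weighted_homogeneous m w (d + e)"
  using assms keys_mult[of f g] weighted_exponents_add[of _ m w d _ e]
  unfolding weighted_homogeneous_iff by fastforce

lemma weighted_homogeneous_one: "1 \<in> weighted_homogeneous m w 0"
  unfolding weighted_homogeneous_iff by (simp add: weighted_exponents_zero)

lemma weighted_homogeneous_power:
  assumes "f \<in> weighted_homogeneous m w d"
  shows "f ^ n \<in> weighted_homogeneous m w (d * n)"
proof (induction n)
  case (Suc n)
  then show ?case using weighted_homogeneous_mult[OF assms Suc.IH] by simp
qed (simp add: weighted_homogeneous_one)

lemma weighted_homogeneous_prod:
  assumes "\<And>i. i \<in> I \<Longrightarrow> f i \<in> weighted_homogeneous m w (d i)"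
  shows "(\<Prod>i\<in>I. f i) \<in> weighted_homogeneous m w (\<Sum>i\<in>I. d i)"
  using assms
  by (induction I rule: infinite_finite_induct)
    (auto intro: weighted_homogeneous_mult weighted_homogeneous_one)

lemma weighted_homogeneous_mvar: "i \<le> m \<Longrightarrow> mvar i \<in> weighted_homogeneous m w (w i)"
  using weighted_exponents_single[of i m 1 w]
  unfolding weighted_homogeneous_iff mvar_def by simp

lemma weighted_homogeneous_msubst:
  assumes f: "f \<in> weighted_homogeneous m w d"
    and \<sigma>: "\<And>i. i \<le> m \<Longrightarrow> \<sigma> i \<in> weighted_homogeneous m w (w i)"
  shows "msubst m \<sigma> f \<in> weighted_homogeneous m w d"
  unfolding msubst_def
proof (intro weighted_homogeneous_sum weighted_homogeneous_scale)
  fix a assume "a \<in> Poly_Mapping.keys f"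
  then have "a \<in> weighted_exponents m w d"
    using f by (auto simp: weighted_homogeneous_iff)
  then have "(\<Sum>i\<le>m. w i * Poly_Mapping.lookup a i) = d"
    by (simp add: weighted_exponents_def)
  moreover have "(\<Prod>i\<le>m. \<sigma> i ^ Poly_Mapping.lookup a i) \<in>
      weighted_homogeneous m w (\<Sum>i\<le>m. w i * Poly_Mapping.lookup a i)"
    by (intro weighted_homogeneous_prod weighted_homogeneous_power \<sigma>) simp
  ultimately show "(\<Prod>i\<le>m. \<sigma> i ^ Poly_Mapping.lookup a i) \<in> weighted_homogeneous m w d" by simp
qed

text \<open>At a unit vector only powers of the single variable \<open>x_i\<close> survive, and the
  weight leaves only the \<open>n\<close>-th power. This reads off the coefficient of a pure power
  from a value, also after a substitution.\<close>

lemma meval_unit_vector: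
  assumes f: "f \<in> weighted_homogeneous m w (w i * n)" and "i \<le> m" "w i > 0" "n > 0"
  shows "meval m f (\<lambda>j. if j = i then 1 else 0) = Poly_Mapping.lookup f (Poly_Mapping.single i n)"
proof -
  have "(\<Prod>j\<le>m. (if j = i then 1 else 0) ^ Poly_Mapping.lookup a j) = (of_bool (a = Poly_Mapping.single i n) :: 'a)"
    if a: "a \<in> Poly_Mapping.keys f" for a
  proof (cases "\<forall>j\<in>{..m}-{i}. Poly_Mapping.lookup a j = 0")
    case True
    have wa: "Poly_Mapping.keys a \<subseteq> {..m}" "(\<Sum>j\<le>m. w j * Poly_Mapping.lookup a j) = w i * n"
      using f a by (auto simp: weighted_homogeneous_iff weighted_exponents_def)
    have "(\<Sum>j\<le>m. w j * Poly_Mapping.lookup a j) = (\<Sum>j\<in>{i}. w j * Poly_Mapping.lookup a j)"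
      using True assms(2) by (intro sum.mono_neutral_right) auto
    with wa(2) assms(3) have "Poly_Mapping.lookup a i = n" by simp
    moreover have "Poly_Mapping.lookup a j = 0" if "j \<noteq> i" for j
      using True wa(1) that by (cases "j \<le> m") (auto simp: in_keys_iff)
    ultimately have "a = Poly_Mapping.single i n"
      by (intro poly_mapping_eqI) (auto simp: lookup_single when_def)
    then show ?thesis by (auto simp: lookup_single when_def intro!: prod.neutral)
  next
    case False
    then obtain j where j: "j \<le> m" "j \<noteq> i" "Poly_Mapping.lookup a j \<noteq> 0" by auto
    then have "a \<noteq> Poly_Mapping.single i n" by (auto simp: lookup_single)
    moreover have "(\<Prod>j\<le>m. (if j = i then 1 else 0 :: 'a) ^ Poly_Mapping.lookup a j) = 0"
      using j by (intro prod_zero) auto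
    ultimately show ?thesis by simp
  qed
  then have "meval m f (\<lambda>j. if j = i then 1 else 0) =
      (\<Sum>a\<in>Poly_Mapping.keys f. Poly_Mapping.lookup f a * of_bool (a = Poly_Mapping.single i n))"
    unfolding meval_def by (intro sum.cong) auto
  also have "\<dots> = (\<Sum>a\<in>Poly_Mapping.keys f. if a = Poly_Mapping.single i n then Poly_Mapping.lookup f a else 0)"
    by (intro sum.cong) auto
  also have "\<dots> = Poly_Mapping.lookup f (Poly_Mapping.single i n)"
    by (auto simp: in_keys_iff)
  finally show ?thesis .
qed

section \<open>Nonzeros of weighted forms\<close>

definition nonzeros :: "nat \<Rightarrow> 'a::{finite,field} mpoly \<Rightarrow> (nat \<Rightarrow> 'a) set" where
  "nonzeros m f = {x \<in> {..m} \<rightarrow>\<^sub>E UNIV. meval m f x \<noteq> 0}"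

locale weight_system =
  fixes m :: nat and w :: "nat \<Rightarrow> nat"
  assumes m_pos: "m \<ge> 1" and w_0: "w 0 = 1" and w_1_pos: "w 1 > 0"
    and w_1_le: "\<And>i. i \<in> {1..m} \<Longrightarrow> w 1 \<le> w i"
begin

lemma atMost_m: "{..m} = insert 0 {1..m}"
  by auto

end

text \<open>The case \<open>k < q\<close>, where the claimed maximum is the expression linear in
  \<open>k\<close> and not \<open>p_m\<close>.\<close>

locale weighted_form = weight_system +
  fixes d k :: nat and f :: "'a::{finite,field} mpoly"
  assumes f: "f \<in> weighted_homogeneous m w d" and f_nz: "f \<noteq> 0" and d_pos: "d \<ge> 1"
    and k: "k = (d - 1) div w 1" and k_less: "k < CARD('a)"
begin

abbreviation affine_degree :: "(nat \<Rightarrow>\<^sub>0 nat) \<Rightarrow> nat" where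
  "affine_degree a \<equiv> (\<Sum>i\<in>{1..m}. Poly_Mapping.lookup a i)"

lemma keys_subset: "a \<in> Poly_Mapping.keys f \<Longrightarrow> Poly_Mapping.keys a \<subseteq> {..m}"
  using f by (auto simp: weighted_homogeneous_iff weighted_exponents_def)

lemma lookup_outside: "a \<in> Poly_Mapping.keys f \<Longrightarrow> i > m \<Longrightarrow> Poly_Mapping.lookup a i = 0"
  using keys_subset[of a] by (auto simp: in_keys_iff subset_iff not_le)

lemma weight_eq:
  assumes "a \<in> Poly_Mapping.keys f"
  shows "Poly_Mapping.lookup a 0 + (\<Sum>i\<in>{1..m}. w i * Poly_Mapping.lookup a i) = d"
proof -
  have "(\<Sum>i\<le>m. w i * Poly_Mapping.lookup a i) = d"
    using f assms by (auto simp: weighted_homogeneous_iff weighted_exponents_def)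
  then show ?thesis by (simp add: atMost_m w_0)
qed

lemma weight_ge: "w 1 * affine_degree a \<le> (\<Sum>i\<in>{1..m}. w i * Poly_Mapping.lookup a i)"
  unfolding sum_distrib_left by (intro sum_mono mult_le_mono1 w_1_le)

lemma d_le: "d \<le> w 1 * Suc k"
  using dividend_less_times_div[of "w 1" "d - 1"] w_1_pos d_pos by (simp add: k)

text \<open>Each of the variables \<open>x_1, ..., x_m\<close> weighs at least \<open>w 1\<close>,
  and \<open>d\<close> is at most \<open>w 1 * (k + 1)\<close>.\<close>

lemma affine_degree_le: "a \<in> Poly_Mapping.keys f \<Longrightarrow> affine_degree a \<le> Suc k"
proof -
  assume "a \<in> Poly_Mapping.keys f"
  then have "w 1 * affine_degree a \<le> w 1 * Suc k"
    using weight_eq[of a] weight_ge[of a] d_le by linarith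
  then show ?thesis using w_1_pos by (simp only: mult_le_cancel1)
qed

text \<open>Equality holds throughout the estimate of the degree by the weight, so there is no room
  for \<open>x_0\<close> or for a variable heavier than \<open>w 1\<close>.\<close>

lemma top_degree:
  assumes a: "a \<in> Poly_Mapping.keys f" "affine_degree a = Suc k"
  shows "d = w 1 * Suc k" "Poly_Mapping.lookup a 0 = 0"
    "\<And>i. i \<in> {1..m} \<Longrightarrow> Poly_Mapping.lookup a i > 0 \<Longrightarrow> w i = w 1"
proof -
  show "d = w 1 * Suc k" "Poly_Mapping.lookup a 0 = 0"
    using weight_eq[OF a(1)] weight_ge[of a] d_le unfolding a(2) by linarith+
  then have eq: "(\<Sum>i\<in>{1..m}. w i * Poly_Mapping.lookup a i) = (\<Sum>i\<in>{1..m}. w 1 * Poly_Mapping.lookup a i)"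
  proof -
    have "(\<Sum>i\<in>{1..m}. w i * Poly_Mapping.lookup a i) = w 1 * affine_degree a"
      using weight_eq[OF a(1)] \<open>d = w 1 * Suc k\<close> \<open>Poly_Mapping.lookup a 0 = 0\<close> unfolding a(2) by linarith
    then show ?thesis by (simp only: sum_distrib_left)
  qed
  show "w i = w 1" if i: "i \<in> {1..m}" "Poly_Mapping.lookup a i > 0" for i
  proof (rule ccontr)
    assume "w i \<noteq> w 1"
    with w_1_le[OF i(1)] have "w 1 < w i" by simp
    then have "(\<Sum>i\<in>{1..m}. w 1 * Poly_Mapping.lookup a i) < (\<Sum>i\<in>{1..m}. w i * Poly_Mapping.lookup a i)"
      using i w_1_le by (intro sum_strict_mono_ex1) auto
    with eq show False by simp
  qed
qed

text \<open>Since \<open>w 0 = 1\<close>, the exponent of \<open>x_0\<close> is determined by the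
  other exponents. Fixing \<open>x_0\<close> therefore never merges two monomials.\<close>

lemma exponent_eqI:
  assumes "a \<in> Poly_Mapping.keys f" "b \<in> Poly_Mapping.keys f"
    and eq: "\<And>i. i \<in> {1..m} \<Longrightarrow> Poly_Mapping.lookup a i = Poly_Mapping.lookup b i"
  shows "a = b"
proof (rule poly_mapping_eqI)
  fix i
  have "(\<Sum>i\<in>{1..m}. w i * Poly_Mapping.lookup a i) = (\<Sum>i\<in>{1..m}. w i * Poly_Mapping.lookup b i)"
    using eq by (intro sum.cong) auto
  then have zero: "Poly_Mapping.lookup a 0 = Poly_Mapping.lookup b 0"
    using weight_eq[OF assms(1)] weight_eq[OF assms(2)] by linarith
  consider "i = 0" | "i \<in> {1..m}" | "i > m" by force
  then show "Poly_Mapping.lookup a i = Poly_Mapping.lookup b i"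
    using zero eq lookup_outside assms(1,2) by cases simp_all
qed

lemma pure_power_eqI:
  assumes a: "a \<in> Poly_Mapping.keys f" "affine_degree a = Suc k"
    and p: "p \<in> {1..m}" "\<And>i. i \<in> {1..m} \<Longrightarrow> i \<noteq> p \<Longrightarrow> Poly_Mapping.lookup a i = 0"
  shows "a = Poly_Mapping.single p (Suc k)"
proof (rule poly_mapping_eqI)
  fix i
  have "affine_degree a = (\<Sum>i\<in>{p}. Poly_Mapping.lookup a i)"
    using p by (intro sum.mono_neutral_right) auto
  then have "Poly_Mapping.lookup a p = Suc k" using a(2) by simp
  moreover have "Poly_Mapping.lookup a i = 0" if "i \<noteq> p"
  proof -
    consider "i = 0" | "i \<in> {1..m}" | "i > m" by force
    then show ?thesis using p(2) that top_degree(2)[OF a] lookup_outside[OF a(1)] by cases auto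
  qed
  ultimately show "Poly_Mapping.lookup a i = Poly_Mapping.lookup (Poly_Mapping.single p (Suc k)) i"
    by (auto simp: lookup_single when_def)
qed

lemma affine_degree_single: "p \<in> {1..m} \<Longrightarrow> affine_degree (Poly_Mapping.single p n) = n"
  by (simp add: lookup_single when_def)

section \<open>Slices with \<open>x_0\<close> fixed\<close>

definition slice_keys :: "'a \<Rightarrow> (nat \<Rightarrow>\<^sub>0 nat) set" where
  "slice_keys c = {a \<in> Poly_Mapping.keys f. c \<noteq> 0 \<or> Poly_Mapping.lookup a 0 = 0}"

definition slice_nonzeros :: "'a \<Rightarrow> (nat \<Rightarrow> 'a) set" where
  "slice_nonzeros c = {y \<in> {1..m} \<rightarrow>\<^sub>E UNIV. meval m f (y(0 := c)) \<noteq> 0}"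

lemma card_nonzeros: "card (nonzeros m f) = (\<Sum>c\<in>UNIV. card (slice_nonzeros c))"
  unfolding nonzeros_def slice_nonzeros_def atMost_m
  by (rule card_nonzero_PiE_insert_slices) auto

lemma meval_slice:
  "meval m f (y(0 := c)) = (\<Sum>a\<in>slice_keys c.
     (Poly_Mapping.lookup f a * c ^ Poly_Mapping.lookup a 0) * (\<Prod>i\<in>{1..m}. y i ^ Poly_Mapping.lookup a i))"
proof -
  have "(\<Prod>i\<in>{1..m}. (y(0 := c)) i ^ Poly_Mapping.lookup a i) = (\<Prod>i\<in>{1..m}. y i ^ Poly_Mapping.lookup a i)" for a
    by (intro prod.cong) auto
  then have "meval m f (y(0 := c)) = (\<Sum>a\<in>Poly_Mapping.keys f.
     (Poly_Mapping.lookup f a * c ^ Poly_Mapping.lookup a 0) * (\<Prod>i\<in>{1..m}. y i ^ Poly_Mapping.lookup a i))"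
    unfolding meval_def atMost_m by (simp add: mult.assoc)
  also have "\<dots> = (\<Sum>a\<in>slice_keys c.
     (Poly_Mapping.lookup f a * c ^ Poly_Mapping.lookup a 0) * (\<Prod>i\<in>{1..m}. y i ^ Poly_Mapping.lookup a i))"
    by (intro sum.mono_neutral_right) (auto simp: slice_keys_def)
  finally show ?thesis .
qed

text \<open>Distinct monomials of \<open>f\<close> stay distinct in \<open>x_1, ..., x_m\<close>, so
  the lexicographic bound applies to each slice. The order \<open>js\<close> is left free so that a
  chosen variable can be put last.\<close>

lemma slice_leading_monomial:
  assumes js: "distinct js" "set js = {1..m}" and ne: "slice_keys c \<noteq> {}"
  shows "\<exists>\<mu>\<in>slice_keys c. (\<Prod>i\<in>{1..m}. CARD('a) - Poly_Mapping.lookup \<mu> i) \<le> card (slice_nonzeros c) \<and>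
    (\<forall>n. (\<forall>i\<in>set (take n js). Poly_Mapping.lookup \<mu> i = 0) \<longrightarrow>
       (\<forall>a\<in>slice_keys c. \<forall>i\<in>set (take n js). Poly_Mapping.lookup a i = 0))"
  unfolding slice_nonzeros_def meval_slice js(2)[symmetric]
proof (rule lex_leading_monomial_nonzeros[OF js(1) _ ne])
  show "finite (slice_keys c)" by (simp add: slice_keys_def)
  show "Poly_Mapping.lookup f a * c ^ Poly_Mapping.lookup a 0 \<noteq> 0" if "a \<in> slice_keys c" for a
    using that by (auto simp: slice_keys_def in_keys_iff)
  show "inj_on (\<lambda>a. restrict (Poly_Mapping.lookup a) (set js)) (slice_keys c)"
  proof (rule inj_onI)
    fix a b assume ab: "a \<in> slice_keys c" "b \<in> slice_keys c"
      "restrict (Poly_Mapping.lookup a) (set js) = restrict (Poly_Mapping.lookup b) (set js)"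
    have "Poly_Mapping.lookup a i = Poly_Mapping.lookup b i" if "i \<in> {1..m}" for i
      using fun_cong[OF ab(3), of i] that js(2) by simp
    then show "a = b" using ab(1,2) by (intro exponent_eqI) (auto simp: slice_keys_def)
  qed
qed

text \<open>The \<open>q - 1\<close> slices with \<open>x_0 \<noteq> 0\<close> already suffice: each
  retains a monomial, and a leading monomial of degree at most \<open>k\<close> leaves at least
  \<open>(q - k) * q ^ (m - 1)\<close> nonzeros.\<close>

lemma nonzeros_small_degree:
  assumes "\<And>a. a \<in> Poly_Mapping.keys f \<Longrightarrow> affine_degree a \<le> k"
  shows "(CARD('a) - 1) * (CARD('a) - k) * CARD('a) ^ (m - 1) \<le> card (nonzeros m f)"
proof -
  let ?q = "CARD('a)"
  have slice: "(?q - k) * ?q ^ (m - 1) \<le> card (slice_nonzeros c)" if "c \<noteq> 0" for c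
  proof -
    have "slice_keys c \<noteq> {}" using f_nz that by (simp add: slice_keys_def)
    moreover have "distinct [1..<Suc m]" "set [1..<Suc m] = {1..m}" by auto
    ultimately obtain \<mu> where \<mu>: "\<mu> \<in> slice_keys c"
      "(\<Prod>i\<in>{1..m}. ?q - Poly_Mapping.lookup \<mu> i) \<le> card (slice_nonzeros c)"
      using slice_leading_monomial[of "[1..<Suc m]" c] by blast
    have "(?q - k) * ?q ^ m \<le> ?q * (\<Prod>i\<in>{1..m}. ?q - Poly_Mapping.lookup \<mu> i)"
      using prod_diff_ge[of "{1..m}" "Poly_Mapping.lookup \<mu>" k ?q] assms \<mu>(1)
      by (simp add: slice_keys_def)
    also have "\<dots> \<le> ?q * card (slice_nonzeros c)" using \<mu>(2) by simp
    also have "(?q - k) * ?q ^ m = ?q * ((?q - k) * ?q ^ (m - 1))"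
      using m_pos by (simp add: power_eq_if)
    finally show ?thesis by simp
  qed
  have "(?q - 1) * (?q - k) * ?q ^ (m - 1) = (\<Sum>c\<in>UNIV - {0::'a}. (?q - k) * ?q ^ (m - 1))"
    by (simp add: card_Diff_singleton)
  also have "\<dots> \<le> (\<Sum>c\<in>UNIV - {0}. card (slice_nonzeros c))"
    using slice by (intro sum_mono) auto
  also have "\<dots> \<le> (\<Sum>c\<in>UNIV. card (slice_nonzeros c))"
    by (intro sum_mono2) auto
  finally show ?thesis by (simp add: card_nonzeros)
qed

text \<open>With \<open>x_0 = 0\<close> and \<open>x_p\<close> the only variable left, the weight
  fixes the exponent. The slice is a single monomial, which can vanish only where \<open>x_p\<close>
  does.\<close>

lemma slice_zero_pure_power:
  assumes p: "p \<in> {1..m}" and ne: "slice_keys 0 \<noteq> {}"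
    and pure: "\<And>a i. a \<in> slice_keys 0 \<Longrightarrow> i \<in> {1..m} \<Longrightarrow> i \<noteq> p \<Longrightarrow> Poly_Mapping.lookup a i = 0"
  shows "(CARD('a) - 1) * CARD('a) ^ (m - 1) \<le> card (slice_nonzeros 0)"
proof -
  obtain a where a: "a \<in> slice_keys 0" using ne by blast
  have wp: "w p > 0" using w_1_le[OF p] w_1_pos by simp
  have weight: "w p * Poly_Mapping.lookup b p = d" if "b \<in> slice_keys 0" for b
  proof -
    have "(\<Sum>i\<in>{1..m}. w i * Poly_Mapping.lookup b i) = (\<Sum>i\<in>{p}. w i * Poly_Mapping.lookup b i)"
      using p pure[OF that] by (intro sum.mono_neutral_right) auto
    then show ?thesis using weight_eq[of b] that by (simp add: slice_keys_def)
  qed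
  have "b = a" if b: "b \<in> slice_keys 0" for b
  proof (rule exponent_eqI)
    fix i assume "i \<in> {1..m}"
    moreover have "Poly_Mapping.lookup b p = Poly_Mapping.lookup a p"
      using weight[OF a] weight[OF b] wp by (metis mult_left_cancel not_gr0)
    ultimately show "Poly_Mapping.lookup b i = Poly_Mapping.lookup a i"
      using pure[OF a] pure[OF b] by (cases "i = p") auto
  qed (use a b in \<open>auto simp: slice_keys_def\<close>)
  then have S: "slice_keys 0 = {a}" using a by blast
  have nz: "meval m f (y(0 := 0)) \<noteq> 0" if "y p \<noteq> 0" for y
  proof -
    have "y i ^ Poly_Mapping.lookup a i \<noteq> 0" if "i \<in> {1..m}" for i
      using pure[OF a that] \<open>y p \<noteq> 0\<close> by (cases "i = p") auto
    then have "(\<Prod>i\<in>{1..m}. y i ^ Poly_Mapping.lookup a i) \<noteq> 0" by simp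
    moreover have "Poly_Mapping.lookup f a \<noteq> 0" "Poly_Mapping.lookup a 0 = 0"
      using a by (auto simp: slice_keys_def in_keys_iff)
    ultimately show ?thesis
      unfolding meval_slice S by (simp del: prod_eq_1_iff)
  qed
  have "{y \<in> {1..m} \<rightarrow>\<^sub>E UNIV. y p \<noteq> 0} \<subseteq> slice_nonzeros 0"
    using nz by (auto simp: slice_nonzeros_def)
  moreover have "finite (slice_nonzeros 0)"
    unfolding slice_nonzeros_def by (intro finite_subset[OF _ finite_PiE[of "{1..m}" "\<lambda>_. UNIV"]]) auto
  ultimately have "card {y \<in> {1..m} \<rightarrow>\<^sub>E (UNIV :: 'a set). y p \<noteq> 0} \<le> card (slice_nonzeros 0)"
    by (intro card_mono)
  then show ?thesis
    using card_PiE_nonzero[of "{1..m}" p, where 'a = 'a] p by simp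
qed

text \<open>\<open>N\<close> is the count in one slice, which has to reach the \<open>q\<close>-th
  part of the bound. In degree at most \<open>k\<close> the extreme case is one variable carrying
  the degree. In degree \<open>k + 1\<close> a monomial that is not a pure power has an exponent
  between 1 and \<open>k\<close>, and the mixed estimate applies.\<close>

lemma mixed_leading_monomial:
  assumes \<mu>: "\<mu> \<in> Poly_Mapping.keys f"
    and not_pure: "\<And>p. p \<in> {1..m} \<Longrightarrow> \<mu> \<noteq> Poly_Mapping.single p (Suc k)"
    and le: "(\<Prod>i\<in>{1..m}. CARD('a) - Poly_Mapping.lookup \<mu> i) \<le> N"
  shows "(CARD('a) - 1) * (CARD('a) - k) * CARD('a) ^ (m - 1) \<le> CARD('a) * N"
proof -
  let ?q = "CARD('a)" and ?P = "\<Prod>i\<in>{1..m}. CARD('a) - Poly_Mapping.lookup \<mu> i"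
  have "(?q - 1) * (?q - k) * ?q ^ m \<le> ?q ^ 2 * ?P"
  proof (cases "affine_degree \<mu> \<le> k")
    case True
    have "(?q - k) * ?q ^ m \<le> ?q * ?P"
      using prod_diff_ge[OF _ True, of ?q] by simp
    then have "(?q - 1) * ((?q - k) * ?q ^ m) \<le> ?q * (?q * ?P)"
      by (rule mult_le_mono[rotated]) simp
    then show ?thesis by (simp only: power2_eq_square mult.assoc)
  next
    case False
    with affine_degree_le[OF \<mu>] have deg: "affine_degree \<mu> = Suc k" by simp
    then have "affine_degree \<mu> \<noteq> 0" by simp
    then obtain i where i: "i \<in> {1..m}" "Poly_Mapping.lookup \<mu> i \<noteq> 0"
      by (meson sum.neutral)
    have split: "affine_degree \<mu> = Poly_Mapping.lookup \<mu> i + (\<Sum>j\<in>{1..m} - {i}. Poly_Mapping.lookup \<mu> j)"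
      using i by (intro sum.remove) auto
    have "Poly_Mapping.lookup \<mu> i \<noteq> Suc k"
    proof
      assume "Poly_Mapping.lookup \<mu> i = Suc k"
      then have "(\<Sum>j\<in>{1..m} - {i}. Poly_Mapping.lookup \<mu> j) = 0" using split deg by linarith
      then have "Poly_Mapping.lookup \<mu> j = 0" if "j \<in> {1..m}" "j \<noteq> i" for j
        using that by (subst (asm) sum_eq_0_iff) auto
      then show False
        using pure_power_eqI[OF \<mu> deg i(1)] not_pure[OF i(1)] by blast
    qed
    with split deg have "Poly_Mapping.lookup \<mu> i \<le> k" by linarith
    then show ?thesis
      using prod_diff_ge_mixed[of "{1..m}" "Poly_Mapping.lookup \<mu>" k ?q i] deg k_less i by simp
  qed
  also have "\<dots> \<le> ?q ^ 2 * N"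
    using le by (rule mult_le_mono2)
  also have "(?q - 1) * (?q - k) * ?q ^ m = ?q * ((?q - 1) * (?q - k) * ?q ^ (m - 1))"
    using m_pos by (simp add: power_eq_if)
  also have "?q ^ 2 * N = ?q * (?q * N)" by (simp add: power2_eq_square)
  finally show ?thesis by simp
qed

text \<open>Each slice reaches the \<open>q\<close>-th part of the bound or involves no variable but
  \<open>x_p\<close>. If \<open>f\<close> itself involves only \<open>x_0\<close> and
  \<open>x_p\<close>, the slices are counted directly; otherwise the exception can occur only at
  \<open>x_0 = 0\<close>, where a single monomial is left and gives at least its share.\<close>

lemma nonzeros_one_pure_power:
  assumes p: "p \<in> {1..m}"
    and no_pure: "\<And>j. j \<in> {1..m} \<Longrightarrow> j \<noteq> p \<Longrightarrow> Poly_Mapping.single j (Suc k) \<notin> Poly_Mapping.keys f"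
  shows "(CARD('a) - 1) * (CARD('a) - k) * CARD('a) ^ (m - 1) \<le> card (nonzeros m f)"
proof (cases "\<exists>b\<in>Poly_Mapping.keys f. affine_degree b = Suc k")
  case False
  then show ?thesis
    using affine_degree_le le_Suc_eq by (intro nonzeros_small_degree) blast
next
  case True
  then obtain b where b: "b \<in> Poly_Mapping.keys f" "affine_degree b = Suc k" by blast
  let ?q = "CARD('a)"
  let ?bound = "(?q - 1) * (?q - k) * ?q ^ (m - 1)"
  \<comment> \<open>The monomial \<open>b\<close> does not contain \<open>x_0\<close>, so it
    survives in every slice, also at \<open>c = 0\<close>.\<close>
  have ne: "slice_keys c \<noteq> {}" for c
    using b top_degree(2)[OF b] by (auto simp: slice_keys_def)
  obtain js where js: "set js = {1..m} - {p}" "distinct js"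
    using finite_distinct_list[of "{1..m} - {p}"] by auto
  have "set (js @ [p]) = insert p ({1..m} - {p})" by (simp add: js(1))
  then have js': "distinct (js @ [p])" "set (js @ [p]) = {1..m}" "take (length js) (js @ [p]) = js"
    using js p by (simp_all only: insert_Diff distinct_append) simp_all
  have slice: "?bound \<le> ?q * card (slice_nonzeros c) \<or>
      (\<forall>a\<in>slice_keys c. \<forall>i\<in>{1..m} - {p}. Poly_Mapping.lookup a i = 0)" for c
  proof -
    obtain \<mu> where \<mu>: "\<mu> \<in> slice_keys c"
      "(\<Prod>i\<in>{1..m}. ?q - Poly_Mapping.lookup \<mu> i) \<le> card (slice_nonzeros c)"
      "\<forall>n. (\<forall>i\<in>set (take n (js @ [p])). Poly_Mapping.lookup \<mu> i = 0) \<longrightarrow>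
       (\<forall>a\<in>slice_keys c. \<forall>i\<in>set (take n (js @ [p])). Poly_Mapping.lookup a i = 0)"
      using slice_leading_monomial[OF js'(1,2) ne[of c]] by blast
    have \<mu>f: "\<mu> \<in> Poly_Mapping.keys f" using \<mu>(1) by (simp add: slice_keys_def)
    show ?thesis
    proof (cases "\<mu> = Poly_Mapping.single p (Suc k)")
      case True
      \<comment> \<open>As \<open>x_p\<close> comes last, a leader free of the earlier variables
        forces the whole slice to be free of them.\<close>
      have "\<forall>i\<in>{1..m} - {p}. Poly_Mapping.lookup \<mu> i = 0"
        by (simp add: True lookup_single)
      then show ?thesis
        using spec[OF \<mu>(3), of "length js"] unfolding js'(3) js(1) by blast
    next
      case False
      then have "?bound \<le> ?q * card (slice_nonzeros c)"
        using no_pure \<mu>f by (intro mixed_leading_monomial[OF \<mu>f _ \<mu>(2)]) metis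
      then show ?thesis ..
    qed
  qed
  show ?thesis
  proof (cases "\<forall>a\<in>Poly_Mapping.keys f. \<forall>i\<in>{1..m} - {p}. Poly_Mapping.lookup a i = 0")
    case True
    have nonzero_slice: "(?q - Suc k) * ?q ^ (m - 1) \<le> card (slice_nonzeros c)" for c
    proof -
      have "distinct [1..<Suc m]" "set [1..<Suc m] = {1..m}" by auto
      then obtain \<mu> where \<mu>: "\<mu> \<in> slice_keys c"
        "(\<Prod>i\<in>{1..m}. ?q - Poly_Mapping.lookup \<mu> i) \<le> card (slice_nonzeros c)"
        using slice_leading_monomial[of "[1..<Suc m]" c] ne by blast
      have \<mu>f: "\<mu> \<in> Poly_Mapping.keys f" using \<mu>(1) by (simp add: slice_keys_def)
      have "Poly_Mapping.lookup \<mu> p \<le> affine_degree \<mu>"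
        using p by (intro member_le_sum) auto
      then have "Poly_Mapping.lookup \<mu> p \<le> Suc k" using affine_degree_le[OF \<mu>f] by linarith
      then have "(?q - Suc k) * ?q ^ (m - 1) \<le> (?q - Poly_Mapping.lookup \<mu> p) * ?q ^ (m - 1)"
        by (intro mult_le_mono1) linarith
      also have "\<dots> = (?q - Poly_Mapping.lookup \<mu> p) * (\<Prod>i\<in>{1..m} - {p}. ?q - Poly_Mapping.lookup \<mu> i)"
      proof -
        have "(\<Prod>i\<in>{1..m} - {p}. ?q - Poly_Mapping.lookup \<mu> i) = (\<Prod>i\<in>{1..m} - {p}. ?q)"
          using True \<mu>f by (intro prod.cong) auto
        then show ?thesis using p by simp
      qed
      also have "\<dots> = (\<Prod>i\<in>{1..m}. ?q - Poly_Mapping.lookup \<mu> i)"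
        using p by (intro prod.remove[symmetric]) auto
      finally show ?thesis using \<mu>(2) by linarith
    qed
    have zero_slice: "(?q - 1) * ?q ^ (m - 1) \<le> card (slice_nonzeros 0)"
      using True by (intro slice_zero_pure_power[OF p ne]) (auto simp: slice_keys_def)
    obtain u where u: "?q = Suc k + u" using k_less le_Suc_ex[of "Suc k" ?q] by auto
    \<comment> \<open>The factor \<open>q - k - 1\<close> in place of \<open>q - k\<close> in the
      \<open>q - 1\<close> slices with \<open>c \<noteq> 0\<close> is made up exactly by the slice
      \<open>c = 0\<close>.\<close>
    have "?bound = (?q - 1) * ((?q - Suc k) * ?q ^ (m - 1)) + (?q - 1) * ?q ^ (m - 1)"
      by (simp add: u algebra_simps)
    also have "\<dots> \<le> (?q - 1) * ((?q - Suc k) * ?q ^ (m - 1)) + card (slice_nonzeros 0)"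
      using zero_slice by (rule add_left_mono)
    also have "(?q - 1) * ((?q - Suc k) * ?q ^ (m - 1)) = (\<Sum>c\<in>UNIV - {0::'a}. (?q - Suc k) * ?q ^ (m - 1))"
      by (simp add: card_Diff_singleton)
    also have "\<dots> \<le> (\<Sum>c\<in>UNIV - {0}. card (slice_nonzeros c))"
      using nonzero_slice by (rule sum_mono)
    finally show ?thesis
      unfolding card_nonzeros using sum.remove[of UNIV "0::'a" "\<lambda>c. card (slice_nonzeros c)"] by simp
  next
    case False
    have "?bound \<le> ?q * card (slice_nonzeros c)" for c
    proof (cases "c = 0")
      case True
      show ?thesis
      proof (cases "\<forall>a\<in>slice_keys 0. \<forall>i\<in>{1..m} - {p}. Poly_Mapping.lookup a i = 0")
        case pure: True
        have "?bound \<le> (?q - 1) * ?q * ?q ^ (m - 1)"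
          by (intro mult_le_mono) auto
        also have "\<dots> = ?q * ((?q - 1) * ?q ^ (m - 1))" by simp
        also have "\<dots> \<le> ?q * card (slice_nonzeros 0)"
          using pure by (intro mult_le_mono2 slice_zero_pure_power[OF p ne]) auto
        finally show ?thesis by (simp add: True)
      qed (use slice[of 0] True in blast)
    next
      case c: False
      then have "slice_keys c = Poly_Mapping.keys f" by (auto simp: slice_keys_def)
      then show ?thesis using slice[of c] False by blast
    qed
    then have "(\<Sum>c\<in>(UNIV :: 'a set). ?bound) \<le> (\<Sum>c\<in>UNIV. ?q * card (slice_nonzeros c))"
      by (rule sum_mono)
    then have "?q * ?bound \<le> ?q * card (nonzeros m f)"
      by (simp add: card_nonzeros sum_distrib_left)
    then show ?thesis by (simp only: mult_le_cancel1) simp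
  qed
qed

text \<open>All coordinates but \<open>x_p\<close> and \<open>x_j\<close> are fixed,
  \<open>x_0\<close> included. The terms of degree \<open>k + 1\<close> in these two do not depend
  on the fixed values, so the anisotropic bound with \<open>e = k + 1\<close> applies to each of the
  \<open>q ^ (m - 1)\<close> planes and leaves at least
  \<open>q ^ 2 - (k + 1) * q + k = (q - 1) * (q - k)\<close> nonzeros.\<close>

lemma nonzeros_anisotropic:
  assumes p: "p \<in> {1..m}" and j: "j \<in> {1..m}" and "p \<noteq> j"
    and pure: "Poly_Mapping.single p (Suc k) \<in> Poly_Mapping.keys f"
      "Poly_Mapping.single j (Suc k) \<in> Poly_Mapping.keys f"
    and anisotropic: "\<And>t. meval m f (\<lambda>i. if i = p then t else if i = j then 1 else 0) \<noteq> 0"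
  shows "(CARD('a) - 1) * (CARD('a) - k) * CARD('a) ^ (m - 1) \<le> card (nonzeros m f)"
proof -
  let ?q = "CARD('a)"
  define I where "I = {..m} - {p, j}"
  have I: "{..m} = insert p (insert j I)" "finite I" "p \<notin> insert j I" "j \<notin> I"
    using p j \<open>p \<noteq> j\<close> by (auto simp: I_def)
  have "card (insert p (insert j I)) = Suc (Suc (card I))" using I by simp
  then have cardI: "card I = m - 1" unfolding I(1)[symmetric] by simp
  have fin: "finite (I \<rightarrow>\<^sub>E (UNIV :: 'a set))" using I(2) by (intro finite_PiE) auto
  have weights: "d = w 1 * Suc k" "w p = w 1" "w j = w 1"
    using top_degree(1)[OF pure(1) affine_degree_single[OF p]]
      top_degree(3)[OF pure(1) affine_degree_single[OF p] p]
      top_degree(3)[OF pure(2) affine_degree_single[OF j] j]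
    by (simp_all add: lookup_single)
  have low: "Poly_Mapping.lookup a p + Poly_Mapping.lookup a j \<le> affine_degree a" for a
  proof -
    have "(\<Sum>i\<in>{p, j}. Poly_Mapping.lookup a i) \<le> affine_degree a"
      using p j by (intro sum_mono2) auto
    then show ?thesis using \<open>p \<noteq> j\<close> by simp
  qed
  have others: "Poly_Mapping.lookup a i = 0"
    if a: "a \<in> Poly_Mapping.keys f" "Poly_Mapping.lookup a p + Poly_Mapping.lookup a j = Suc k" and i: "i \<in> I" for a i
  proof -
    have deg: "affine_degree a = Suc k" using low[of a] a affine_degree_le[OF a(1)] by linarith
    show ?thesis
    proof (cases "i = 0")
      case False
      with i have i': "i \<in> {1..m}" "i \<noteq> p" "i \<noteq> j" by (auto simp: I_def)
      have "(\<Sum>i\<in>{p, j, i}. Poly_Mapping.lookup a i) \<le> affine_degree a"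
        using p j i' by (intro sum_mono2) auto
      then show ?thesis using \<open>p \<noteq> j\<close> i' deg a by simp
    qed (use top_degree(2)[OF a(1) deg] in simp)
  qed
  have slice: "(?q - 1) * (?q - k) \<le> (\<Sum>b\<in>UNIV. card {a. meval m f (x(j := b, p := a)) \<noteq> 0})" for x
  proof -
    define C where "C a = Poly_Mapping.lookup f a * (\<Prod>i\<in>I. x i ^ Poly_Mapping.lookup a i)" for a
    have C_top: "C a = Poly_Mapping.lookup f a"
      if "a \<in> Poly_Mapping.keys f" "Poly_Mapping.lookup a p + Poly_Mapping.lookup a j = Suc k" for a
      unfolding C_def using others[OF that] by simp
    have meval: "meval m f (x(j := b, p := a)) =
      (\<Sum>s\<in>Poly_Mapping.keys f. C s * a ^ Poly_Mapping.lookup s p * b ^ Poly_Mapping.lookup s j)" for a b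
    proof -
      have "(\<Prod>i\<le>m. (x(j := b, p := a)) i ^ Poly_Mapping.lookup s i) =
        a ^ Poly_Mapping.lookup s p * b ^ Poly_Mapping.lookup s j * (\<Prod>i\<in>I. x i ^ Poly_Mapping.lookup s i)" for s
      proof -
        have "(\<Prod>i\<in>I. (x(j := b, p := a)) i ^ Poly_Mapping.lookup s i) = (\<Prod>i\<in>I. x i ^ Poly_Mapping.lookup s i)"
          using I by (intro prod.cong) auto
        then show ?thesis unfolding I(1) using I \<open>p \<noteq> j\<close> by (simp add: mult_ac)
      qed
      then show ?thesis by (simp add: meval_def C_def mult_ac)
    qed
    let ?Z = "{(a, b). (\<Sum>s\<in>Poly_Mapping.keys f. C s * a ^ Poly_Mapping.lookup s p * b ^ Poly_Mapping.lookup s j) = 0}"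
    have "card ?Z + (Suc k - 1) \<le> Suc k * ?q"
    proof (rule anisotropic_zeros_bound)
      show "Poly_Mapping.lookup s p + Poly_Mapping.lookup s j \<le> Suc k" if "s \<in> Poly_Mapping.keys f" for s
        using low[of s] affine_degree_le[OF that] by linarith
      have "s = Poly_Mapping.single p (Suc k)"
        if s: "s \<in> Poly_Mapping.keys f" "Poly_Mapping.lookup s p = Suc k" for s
      proof (rule pure_power_eqI[OF s(1) _ p])
        show deg: "affine_degree s = Suc k"
          using low[of s] s affine_degree_le[OF s(1)] by linarith
        then have "Poly_Mapping.lookup s j = 0" using low[of s] s by linarith
        then show "Poly_Mapping.lookup s i = 0" if "i \<in> {1..m}" "i \<noteq> p" for i
          using others[OF s(1), of i] s(2) that by (cases "i = j") (auto simp: I_def)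
      qed
      moreover have "Poly_Mapping.lookup (Poly_Mapping.single p (Suc k)) p = Suc k" by simp
      ultimately have "{s \<in> Poly_Mapping.keys f. Poly_Mapping.lookup s p = Suc k} = {Poly_Mapping.single p (Suc k)}"
        using pure(1) by blast
      then show "(\<Sum>s\<in>{s \<in> Poly_Mapping.keys f. Poly_Mapping.lookup s p = Suc k}. C s) \<noteq> 0"
        using C_top[OF pure(1)] pure(1) \<open>p \<noteq> j\<close> by (simp add: lookup_single in_keys_iff)
    next
      fix t
      have "meval m f (\<lambda>i. if i = p then t else if i = j then 1 else 0) =
        (\<Sum>s\<in>{s \<in> Poly_Mapping.keys f. Poly_Mapping.lookup s p + Poly_Mapping.lookup s j = Suc k}. C s * t ^ Poly_Mapping.lookup s p)"
        unfolding meval_def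
      proof (rule sum.mono_neutral_cong_right)
        show "\<forall>s\<in>Poly_Mapping.keys f - {s \<in> Poly_Mapping.keys f. Poly_Mapping.lookup s p + Poly_Mapping.lookup s j = Suc k}.
          Poly_Mapping.lookup f s * (\<Prod>i\<le>m. (if i = p then t else if i = j then 1 else 0) ^ Poly_Mapping.lookup s i) = 0"
        proof
          fix s assume s: "s \<in> Poly_Mapping.keys f - {s \<in> Poly_Mapping.keys f. Poly_Mapping.lookup s p + Poly_Mapping.lookup s j = Suc k}"
          \<comment> \<open>A monomial in \<open>x_p\<close> and \<open>x_j\<close> alone would have
            degree \<open>k + 1\<close>, because both have weight \<open>w 1\<close> and
            \<open>d = w 1 * (k + 1)\<close>.\<close>
          have "\<exists>i\<in>I. Poly_Mapping.lookup s i \<noteq> 0"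
          proof (rule ccontr)
            assume "\<not> ?thesis"
            then have zero: "\<forall>i\<in>I. Poly_Mapping.lookup s i = 0" by blast
            have "(\<Sum>i\<le>m. w i * Poly_Mapping.lookup s i) = d"
              using f s by (auto simp: weighted_homogeneous_iff weighted_exponents_def)
            then have "w 1 * (Poly_Mapping.lookup s p + Poly_Mapping.lookup s j) = w 1 * Suc k"
              unfolding I(1) using I zero weights by (simp add: distrib_left)
            then have "Poly_Mapping.lookup s p + Poly_Mapping.lookup s j = Suc k"
              using w_1_pos by (subst (asm) mult_cancel1) simp
            then show False using s by simp
          qed
          then obtain i where i: "i \<in> I" "Poly_Mapping.lookup s i \<noteq> 0" by blast
          then have "(\<Prod>i\<le>m. (if i = p then t else if i = j then 1 else 0) ^ Poly_Mapping.lookup s i) = 0"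
            by (intro prod_zero) (auto simp: I_def intro!: bexI[of _ i])
          then show "Poly_Mapping.lookup f s * (\<Prod>i\<le>m. (if i = p then t else if i = j then 1 else 0) ^ Poly_Mapping.lookup s i) = 0"
            by simp
        qed
      next
        fix s assume "s \<in> {s \<in> Poly_Mapping.keys f. Poly_Mapping.lookup s p + Poly_Mapping.lookup s j = Suc k}"
        then have s: "s \<in> Poly_Mapping.keys f" "Poly_Mapping.lookup s p + Poly_Mapping.lookup s j = Suc k" by auto
        have "(\<Prod>i\<in>I. (if i = p then t else if i = j then 1 else 0) ^ Poly_Mapping.lookup s i) = 1"
          using others[OF s] by (intro prod.neutral) auto
        then have "(\<Prod>i\<le>m. (if i = p then t else if i = j then 1 else 0) ^ Poly_Mapping.lookup s i) = t ^ Poly_Mapping.lookup s p"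
          unfolding I(1) using I(2-4) \<open>p \<noteq> j\<close> by simp
        then show "Poly_Mapping.lookup f s * (\<Prod>i\<le>m. (if i = p then t else if i = j then 1 else 0) ^ Poly_Mapping.lookup s i) =
          C s * t ^ Poly_Mapping.lookup s p"
          by (simp add: C_top[OF s])
      qed auto
      with anisotropic[of t]
      show "(\<Sum>s\<in>{s \<in> Poly_Mapping.keys f. Poly_Mapping.lookup s p + Poly_Mapping.lookup s j = Suc k}. C s * t ^ Poly_Mapping.lookup s p) \<noteq> 0"
        by simp
    qed (use k_less in auto)
    moreover have "(\<Sum>b\<in>UNIV. card {a. meval m f (x(j := b, p := a)) \<noteq> 0}) = card (UNIV - ?Z)"
    proof -
      have "bij_betw (\<lambda>(b, a). (a, b)) (SIGMA b:UNIV. {a. meval m f (x(j := b, p := a)) \<noteq> 0}) (UNIV - ?Z)"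
        by (rule bij_betwI[where g = "\<lambda>(a, b). (b, a)"]) (auto simp: meval)
      from bij_betw_same_card[OF this] show ?thesis by simp
    qed
    moreover have "card (UNIV - ?Z) = ?q * ?q - card ?Z"
      by (subst card_Diff_subset) (auto simp: card_cartesian_product simp flip: UNIV_Times_UNIV)
    moreover have "(?q - 1) * (?q - k) + Suc k * ?q = ?q * ?q + k"
    proof -
      obtain u where "?q = Suc k + u" using k_less le_Suc_ex[of "Suc k" ?q] by auto
      then show ?thesis by (simp add: algebra_simps)
    qed
    ultimately show ?thesis by linarith
  qed
  have "(?q - 1) * (?q - k) * ?q ^ (m - 1) = (\<Sum>x\<in>I \<rightarrow>\<^sub>E (UNIV :: 'a set). (?q - 1) * (?q - k))"
    using cardI I(2) by (simp add: card_PiE)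
  also have "\<dots> \<le> (\<Sum>x\<in>I \<rightarrow>\<^sub>E UNIV. \<Sum>b\<in>UNIV. card {a. meval m f (x(j := b, p := a)) \<noteq> 0})"
    using slice by (rule sum_mono)
  also have "\<dots> = (\<Sum>b\<in>UNIV. \<Sum>x\<in>I \<rightarrow>\<^sub>E UNIV. card {a. meval m f (x(j := b, p := a)) \<noteq> 0})"
    by (rule sum.swap)
  also have "\<dots> = card (nonzeros m f)"
  proof -
    have "card (nonzeros m f) = (\<Sum>x\<in>insert j I \<rightarrow>\<^sub>E UNIV. card {a. meval m f (x(p := a)) \<noteq> 0})"
      unfolding nonzeros_def I(1) by (rule card_nonzero_PiE_insert) (use I in auto)
    also have "\<dots> = (\<Sum>b\<in>UNIV. \<Sum>x\<in>I \<rightarrow>\<^sub>E UNIV. card {a. meval m f (x(j := b, p := a)) \<noteq> 0})"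
    proof -
      have "(\<Sum>x\<in>insert j I \<rightarrow>\<^sub>E UNIV. card {a. meval m f (x(p := a)) \<noteq> 0}) =
        (\<Sum>(b, x)\<in>UNIV \<times> (I \<rightarrow>\<^sub>E UNIV). card {a. meval m f (x(j := b, p := a)) \<noteq> 0})"
        using I(4) by (subst PiE_insert_eq, subst sum.reindex)
          (auto simp: case_prod_beta comp_def intro!: inj_on_subset[OF inj_combinator])
      then show ?thesis by (simp add: sum.cartesian_product)
    qed
    finally show ?thesis by simp
  qed
  finally show ?thesis .
qed

text \<open>Unless some pair is anisotropic, one shear adding the sum of all
  \<open>r j * x_j\<close> to \<open>x_p\<close> removes all other pure powers at once. It respects
  the weights, since every variable with such a power in \<open>f\<close> has weight
  \<open>w 1\<close>, and it permutes the points.\<close>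

lemma nonzeros_lower_bound:
  "(CARD('a) - 1) * (CARD('a) - k) * CARD('a) ^ (m - 1) \<le> card (nonzeros m f)" (is "?bound \<le> _")
proof (cases "\<exists>p\<in>{1..m}. Poly_Mapping.single p (Suc k) \<in> Poly_Mapping.keys f")
  case False
  then show ?thesis
    using m_pos by (intro nonzeros_one_pure_power[of 1]) auto
next
  case True
  then obtain p where p: "p \<in> {1..m}" and pure_p: "Poly_Mapping.single p (Suc k) \<in> Poly_Mapping.keys f"
    by blast
  have pure_weight: "w i = w 1" if "i \<in> {1..m}" "Poly_Mapping.single i (Suc k) \<in> Poly_Mapping.keys f" for i
    using top_degree(3)[OF that(2) affine_degree_single[OF that(1)] that(1)] by simp
  have d: "d = w 1 * Suc k"
    using top_degree(1)[OF pure_p affine_degree_single[OF p]] .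
  have unit_vector: "meval m g (\<lambda>i. if i = j then 1 else 0) = Poly_Mapping.lookup g (Poly_Mapping.single j (Suc k))"
    if "g \<in> weighted_homogeneous m w d" "j \<in> {1..m}" "w j = w 1" for j and g :: "'a mpoly"
    using meval_unit_vector[of g m w j "Suc k"] that w_1_pos by (simp add: d)
  define J where "J = {j \<in> {1..m}. j \<noteq> p \<and> Poly_Mapping.single j (Suc k) \<in> Poly_Mapping.keys f}"
  show ?thesis
  proof (cases "\<exists>j\<in>J. \<forall>t. meval m f (\<lambda>i. if i = p then t else if i = j then 1 else 0) \<noteq> 0")
    case True
    then obtain j where "j \<in> {1..m}" "p \<noteq> j" "Poly_Mapping.single j (Suc k) \<in> Poly_Mapping.keys f"
      "\<And>t. meval m f (\<lambda>i. if i = p then t else if i = j then 1 else 0) \<noteq> 0"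
      unfolding J_def by blast
    then show ?thesis
      by (intro nonzeros_anisotropic[OF p _ _ pure_p])
  next
    case False
    then have "\<forall>j\<in>J. \<exists>t. meval m f (\<lambda>i. if i = p then t else if i = j then 1 else 0) = 0" by blast
    then obtain r where r: "\<And>j. j \<in> J \<Longrightarrow> meval m f (\<lambda>i. if i = p then r j else if i = j then 1 else 0) = 0"
      by metis
    define \<sigma> :: "nat \<Rightarrow> 'a mpoly" where
      "\<sigma> i = mvar i + (if i = p then (\<Sum>j\<in>J. Poly_Mapping.single 0 (r j) * mvar j) else 0)" for i
    define f' where "f' = msubst m \<sigma> f"
    have J_le: "j \<in> {1..m}" "j \<noteq> p" if "j \<in> J" for j using that by (auto simp: J_def)
    have p_le: "p \<le> m" "p \<ge> 1" using p by auto
    have f': "f' \<in> weighted_homogeneous m w d"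
      unfolding f'_def
    proof (rule weighted_homogeneous_msubst[OF f])
      fix i assume i: "i \<le> m"
      have "(\<Sum>j\<in>J. Poly_Mapping.single 0 (r j) * mvar j) \<in> weighted_homogeneous m w (w p)"
      proof (intro weighted_homogeneous_sum weighted_homogeneous_scale)
        fix j assume "j \<in> J"
        then have "w j = w p" "j \<le> m"
          using pure_weight[of j] pure_weight[OF p pure_p] by (auto simp: J_def)
        then show "mvar j \<in> weighted_homogeneous m w (w p)"
          using weighted_homogeneous_mvar[of j m w] by simp
      qed
      moreover have "0 \<in> weighted_homogeneous m w (w i)"
        by (simp add: weighted_homogeneous_iff)
      ultimately show "\<sigma> i \<in> weighted_homogeneous m w (w i)"
        unfolding \<sigma>_def by (intro weighted_homogeneous_add weighted_homogeneous_mvar i) auto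
    qed
    define T where "T x = x(p := x p + (\<Sum>j\<in>J. r j * x j))" for x :: "nat \<Rightarrow> 'a"
    have meval_f': "meval m f' x = meval m f (T x)" for x
      unfolding f'_def meval_msubst
    proof (rule meval_cong)
      fix i assume i: "i \<le> m"
      have "meval m (\<Sum>j\<in>J. Poly_Mapping.single 0 (r j) * mvar j) x = (\<Sum>j\<in>J. r j * x j)"
        unfolding meval_sum using J_le by (intro sum.cong) (auto simp: meval_mult meval_single)
      then show "meval m (\<sigma> i) x = T x i"
        using i by (simp add: \<sigma>_def T_def meval_add)
    qed
    \<comment> \<open>The unit vector in direction \<open>j \<in> J\<close> goes to the vector with
      \<open>r j\<close> in coordinate \<open>p\<close> and 1 in coordinate \<open>j\<close>, a zero
      of \<open>f\<close> by the choice of \<open>r\<close>.\<close>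
    have T_unit: "T (\<lambda>i. if i = j then 1 else 0) = (\<lambda>i. if i = p then (if j = p then 1 else if j \<in> J then r j else 0) else if i = j then 1 else 0)" for j
    proof -
      have "finite J" by (simp add: J_def)
      have "(\<Sum>i\<in>J. r i * (if i = j then 1 else 0)) = (\<Sum>i\<in>J. if i = j then r i else 0)"
        by (intro sum.cong) auto
      also have "\<dots> = (if j \<in> J then r j else 0)"
        using \<open>finite J\<close> by simp
      finally show ?thesis using J_le(2) by (auto simp: T_def fun_eq_iff)
    qed
    \<comment> \<open>\<open>T\<close> fixes the unit vector at \<open>p\<close>, so this
      coefficient is unchanged and \<open>f'\<close> is nonzero.\<close>
    have "Poly_Mapping.lookup f' (Poly_Mapping.single p (Suc k)) = meval m f (\<lambda>i. if i = p then 1 else 0)"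
      using unit_vector[OF f' p pure_weight[OF p pure_p]] by (simp add: meval_f' T_unit if_distrib cong: if_cong)
    also have "\<dots> = Poly_Mapping.lookup f (Poly_Mapping.single p (Suc k))"
      using unit_vector[OF f p pure_weight[OF p pure_p]] .
    also have "\<dots> \<noteq> 0" using pure_p by (simp add: in_keys_iff)
    finally have "f' \<noteq> 0" by auto
    then interpret f': weighted_form m w d k f'
      using f' d_pos k k_less by unfold_locales auto
    \<comment> \<open>For weight \<open>w 1\<close> the coefficient is a value of \<open>f\<close>:
      if \<open>j \<in> J\<close> it vanishes by the choice of \<open>r\<close>, otherwise it is the
      old coefficient, which was zero. A heavier variable admits no power of this degree.\<close>
    have "Poly_Mapping.single j (Suc k) \<notin> Poly_Mapping.keys f'" if j: "j \<in> {1..m}" "j \<noteq> p" for j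
    proof (cases "w j = w 1")
      case True
      have "Poly_Mapping.lookup f' (Poly_Mapping.single j (Suc k)) =
        meval m f (\<lambda>i. if i = p then (if j \<in> J then r j else 0) else if i = j then 1 else 0)"
        unfolding unit_vector[OF f' j(1) True, symmetric] meval_f' T_unit using j(2) by simp
      also have "\<dots> = 0"
      proof (cases "j \<in> J")
        case False
        have "meval m f (\<lambda>i. if i = j then 1 else 0) = Poly_Mapping.lookup f (Poly_Mapping.single j (Suc k))"
          using unit_vector[OF f j(1) True] .
        also have "\<dots> = 0" using False j by (auto simp: J_def in_keys_iff)
        also have "(\<lambda>i. if i = j then 1 else 0 :: 'a) = (\<lambda>i. if i = p then 0 else if i = j then 1 else 0)"
          using j(2) by auto
        finally show ?thesis using False by simp
      qed (use r in simp)
      finally show ?thesis by (simp add: in_keys_iff)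
    next
      case False
      then show ?thesis
        using f'.top_degree(3)[OF _ f'.affine_degree_single[OF j(1)] j(1)] by (auto simp: lookup_single)
    qed
    then have "?bound \<le> card (nonzeros m f')"
      by (rule f'.nonzeros_one_pure_power[OF p])
    also have "card (nonzeros m f') = card (nonzeros m f)"
    proof (rule bij_betw_same_card)
      \<comment> \<open>\<open>J\<close> does not contain \<open>p\<close>, so the sum is the same
        before and after the shear, and subtracting it inverts \<open>T\<close>.\<close>
      define T' where "T' x = x(p := x p - (\<Sum>j\<in>J. r j * x j))" for x :: "nat \<Rightarrow> 'a"
      have sum_T: "(\<Sum>j\<in>J. r j * (x(p := c)) j) = (\<Sum>j\<in>J. r j * x j)" for x c
        using J_le(2) by (intro sum.cong) auto
      have TT': "T (T' x) = x" "T' (T x) = x" for x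
        unfolding T_def T'_def sum_T by auto
      show "bij_betw T (nonzeros m f') (nonzeros m f)"
      proof (rule bij_betwI[where g = T'])
        show "T \<in> nonzeros m f' \<rightarrow> nonzeros m f"
          using p_le by (auto simp: nonzeros_def meval_f' T_def PiE_iff extensional_def)
        show "T' \<in> nonzeros m f \<rightarrow> nonzeros m f'"
        proof
          fix x assume "x \<in> nonzeros m f"
          then show "T' x \<in> nonzeros m f'"
            using p_le TT'(1)[of x] by (auto simp: nonzeros_def meval_f' T'_def PiE_iff extensional_def)
        qed
      qed (use TT' in auto)
    qed
    finally show ?thesis .
  qed
qed

end

section \<open>Representatives of rational points\<close>

text \<open>\<open>x ^ q - x\<close> has at most \<open>q\<close> roots, and the base field already
  supplies \<open>q\<close>.\<close>

lemma frobenius_fixed_imp_range: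
  fixes z :: "'a::{finite,field} alg_closure"
  assumes "z ^ CARD('a) = z"
  shows "z \<in> range to_ac"
proof -
  define P :: "'a alg_closure poly" where "P = monom 1 CARD('a) - monom 1 1"
  have q: "CARD('a) \<ge> 2" by (rule card_field_ge_2)
  then have "coeff P 1 = -1" by (simp add: P_def)
  then have "P \<noteq> 0" by auto
  have roots: "{z. poly P z = 0} = {z. z ^ CARD('a) = z}"
    by (simp add: P_def poly_monom)
  have "degree P \<le> CARD('a)"
    unfolding P_def using q by (intro degree_diff_le order_trans[OF degree_monom_le]) auto
  then have "card {z :: 'a alg_closure. z ^ CARD('a) = z} \<le> CARD('a)"
    using card_poly_roots_bound[OF \<open>P \<noteq> 0\<close>] roots by simp
  also have "CARD('a) = card (range (to_ac :: 'a \<Rightarrow> _))"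
    by (rule card_image[symmetric]) (rule inj_to_ac)
  finally have "card {z :: 'a alg_closure. z ^ CARD('a) = z} \<le> card (range (to_ac :: 'a \<Rightarrow> _))" .
  moreover have "range (to_ac :: 'a \<Rightarrow> _) \<subseteq> {z. z ^ CARD('a) = z}"
    using finite_field_power_card by (auto simp flip: to_ac_power)
  moreover have "finite {z :: 'a alg_closure. z ^ CARD('a) = z}"
    using poly_roots_finite[OF \<open>P \<noteq> 0\<close>] roots by simp
  ultimately have "range (to_ac :: 'a \<Rightarrow> _) = {z. z ^ CARD('a) = z}"
    by (intro card_seteq)
  with assms show ?thesis by blast
qed

lemma power_gcd_eq_1:
  fixes u :: "'a::comm_monoid_mult"
  assumes "u ^ a = 1" "u ^ b = 1"
  shows "u ^ gcd a b = 1"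
proof (cases "a = 0")
  case False
  then obtain x y where "a * x = b * y + gcd a b"
    using bezout_nat by blast
  then have "u ^ (a * x) = u ^ (b * y) * u ^ gcd a b"
    by (simp add: power_add)
  then show ?thesis
    using assms by (simp add: power_mult)
qed (use assms in simp)

lemma power_Gcd_eq_1:
  fixes u :: "'a::comm_monoid_mult" and A :: "nat set"
  assumes "finite A" "\<And>a. a \<in> A \<Longrightarrow> u ^ a = 1"
  shows "u ^ Gcd A = 1"
  using assms by (induction rule: finite_induct) (auto intro: power_gcd_eq_1)

definition embed :: "nat \<Rightarrow> (nat \<Rightarrow> 'a::field) \<Rightarrow> nat \<Rightarrow> 'a alg_closure" where
  "embed m x = (\<lambda>i\<in>{..m}. to_ac (x i))"

text \<open>The scalar ranges over the algebraic closure, since \<open>c\<close> need not lie in the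
  base field for \<open>c \<cdot> x\<close> to have its coordinates there.\<close>

definition orbit_points :: "nat \<Rightarrow> (nat \<Rightarrow> nat) \<Rightarrow> (nat \<Rightarrow> 'a::field) \<Rightarrow> (nat \<Rightarrow> 'a) set" where
  "orbit_points m w x = {y \<in> {..m} \<rightarrow>\<^sub>E UNIV.
     \<exists>c :: 'a alg_closure. c \<noteq> 0 \<and> (\<forall>i\<le>m. to_ac (y i) = c ^ w i * to_ac (x i))}"

text \<open>With \<open>n\<close> the greatest common divisor of the weights on the support of \<open>x\<close>, the point \<open>c \<cdot> x\<close>
  only depends on \<open>u = c\<^sup>n\<close>, and it has coordinates in \<open>F\<^sub>q\<close> exactly when \<open>u\<close> lies in \<open>F\<^sub>q\<close>.\<close>

lemma card_orbit_points:
  fixes x :: "nat \<Rightarrow> 'a::{finite,field}"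
  assumes w: "\<And>i. i \<le> m \<Longrightarrow> w i > 0" and x: "\<exists>i\<le>m. x i \<noteq> 0"
  shows "card (orbit_points m w x) = CARD('a) - 1"
proof -
  define I where "I = {i. i \<le> m \<and> x i \<noteq> 0}"
  define n where "n = Gcd (w ` I)"
  have I: "finite I" "I \<noteq> {}" using x by (auto simp: I_def)
  have n_dvd: "n dvd w i" if "i \<in> I" for i
    unfolding n_def using that by (intro Gcd_dvd) auto
  have n_pos: "n > 0"
    using I n_dvd w by (fastforce simp: I_def intro: Nat.gr0I)
  have w_eq: "w i = n * (w i div n)" if "i \<in> I" for i
    using n_dvd[OF that] by simp
  have power_n: "z ^ n = 1" if "\<And>i. i \<in> I \<Longrightarrow> z ^ w i = 1" for z :: "'a alg_closure"
    unfolding n_def using I that by (intro power_Gcd_eq_1) auto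
  define act where "act u = (\<lambda>i\<in>{..m}. u ^ (w i div n) * x i)" for u
  have "bij_betw act (UNIV - {0}) (orbit_points m w x)"
    unfolding bij_betw_def
  proof (intro conjI equalityI subsetI inj_onI)
    fix u v assume uv: "u \<in> UNIV - {0}" "v \<in> UNIV - {0}" "act u = act v"
    \<comment> \<open>Any \<open>n\<close>-th root \<open>z\<close> of \<open>u / v\<close>
      satisfies \<open>z ^ w i = 1\<close> on the support, hence \<open>z ^ n = 1\<close> for the
      greatest common divisor \<open>n\<close>.\<close>
    obtain z where z: "z ^ n = to_ac (u / v)"
      using nth_root_exists[OF n_pos] by blast
    have "z ^ w i = 1" if i: "i \<in> I" for i
    proof -
      have "u ^ (w i div n) = v ^ (w i div n)"
        using fun_cong[OF uv(3), of i] i by (simp add: act_def I_def)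
      have "z ^ w i = (z ^ n) ^ (w i div n)"
        by (subst w_eq[OF i]) (simp only: power_mult)
      also have "\<dots> = to_ac (u ^ (w i div n) / v ^ (w i div n))"
        by (simp add: z power_divide)
      also have "\<dots> = 1"
        using \<open>u ^ (w i div n) = v ^ (w i div n)\<close> uv(2) by simp
      finally show ?thesis .
    qed
    then have "z ^ n = 1" by (rule power_n)
    with z have "to_ac (u / v) = to_ac 1" by simp
    then have "u / v = 1" by (simp only: to_ac_eq_iff)
    then show "u = v" using uv(2) by simp
  next
    fix y assume "y \<in> act ` (UNIV - {0})"
    then obtain u where u: "u \<noteq> 0" "y = act u" by auto
    obtain c :: "'a alg_closure" where c: "c ^ n = to_ac u"
      using nth_root_exists[OF n_pos] by blast
    have "c \<noteq> 0" using c u n_pos by (auto simp: power_0_left)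
    moreover have "to_ac (y i) = c ^ w i * to_ac (x i)" if "i \<le> m" for i
    proof (cases "i \<in> I")
      case True
      have "c ^ w i = (c ^ n) ^ (w i div n)"
        by (subst w_eq[OF True]) (simp only: power_mult)
      then show ?thesis using that by (simp add: u act_def c)
    qed (use that in \<open>simp add: u act_def I_def\<close>)
    ultimately show "y \<in> orbit_points m w x"
      unfolding orbit_points_def by (auto simp: u act_def)
  next
    fix y assume "y \<in> orbit_points m w x"
    then obtain c :: "'a alg_closure" where y: "y \<in> {..m} \<rightarrow>\<^sub>E UNIV" and "c \<noteq> 0"
      and c: "\<And>i. i \<le> m \<Longrightarrow> to_ac (y i) = c ^ w i * to_ac (x i)"
      by (auto simp: orbit_points_def)
    \<comment> \<open>On the support \<open>c ^ w i\<close> is a nonzero element of the base field,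
      so its power with exponent \<open>q - 1\<close> is 1. The greatest common divisor turns this
      into a statement about \<open>c ^ n\<close>, which is then fixed by Frobenius.\<close>
    have "(c ^ (CARD('a) - 1)) ^ w i = 1" if "i \<in> I" for i
    proof -
      have i: "i \<le> m" "x i \<noteq> 0" using that by (auto simp: I_def)
      have eq: "c ^ w i = to_ac (y i / x i)"
        using c[OF i(1)] i(2) by simp
      then have "y i / x i \<noteq> 0" using \<open>c \<noteq> 0\<close> by auto
      have "(c ^ (CARD('a) - 1)) ^ w i = (c ^ w i) ^ (CARD('a) - 1)"
        by (simp only: mult.commute flip: power_mult)
      also have "\<dots> = to_ac ((y i / x i) ^ (CARD('a) - 1))"
        by (simp only: eq to_ac_power)
      also have "\<dots> = 1"
        using finite_field_power_card_minus_1[OF \<open>y i / x i \<noteq> 0\<close>] by (simp only: to_ac_1)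
      finally show ?thesis .
    qed
    then have "(c ^ (CARD('a) - 1)) ^ n = 1" by (rule power_n)
    then have "(c ^ n) ^ (CARD('a) - 1) = 1"
      by (simp only: mult.commute flip: power_mult)
    then have "(c ^ n) ^ CARD('a) = c ^ n"
      using power_minus_mult[of "CARD('a)" "c ^ n"] by simp
    then have "c ^ n \<in> range to_ac" by (rule frobenius_fixed_imp_range)
    then obtain u :: 'a where u: "c ^ n = to_ac u" by blast
    have "u \<noteq> 0" using u \<open>c \<noteq> 0\<close> by auto
    moreover have "y = act u"
    proof (rule PiE_ext[OF y])
      show "act u \<in> {..m} \<rightarrow>\<^sub>E UNIV" by (simp add: act_def)
      fix i assume "i \<in> {..m}"
      then have i: "i \<le> m" by simp
      have "to_ac (y i) = to_ac (act u i)"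
      proof (cases "i \<in> I")
        case True
        have "c ^ w i = (c ^ n) ^ (w i div n)"
          by (subst w_eq[OF True]) (simp only: power_mult)
        then show ?thesis using c[OF i] i by (simp add: act_def u)
      qed (use c[OF i] i in \<open>simp add: act_def I_def\<close>)
      then show "y i = act u i" by simp
    qed
    ultimately show "y \<in> act ` (UNIV - {0})" by blast
  qed
  then have "card (UNIV - {0::'a}) = card (orbit_points m w x)"
    by (rule bij_betw_same_card)
  then show ?thesis by (simp add: card_Diff_singleton)
qed

lemma embed_in_punctured_space: "embed m x \<in> punctured_space m \<longleftrightarrow> (\<exists>i\<le>m. x i \<noteq> 0)"
  by (auto simp: embed_def punctured_space_def)

lemma frob_embed: "frob m (embed m x) = embed m (x :: nat \<Rightarrow> 'a::{finite,field})"
  using finite_field_power_card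
  by (auto simp: frob_def embed_def fun_eq_iff simp flip: to_ac_power)

lemma frob_class_eq:
  assumes "z \<in> punctured_space m"
  shows "frob_class m w (wp_rel m w `` {z}) = wp_rel m w `` {frob m z}"
  unfolding frob_class_def
  by (rule UN_equiv_class[OF equiv_wp_rel congruent_frob assms])

lemma embed_class_rational:
  assumes "\<exists>i\<le>m. x i \<noteq> 0"
  shows "wp_rel m w `` {embed m x} \<in> rational_points m w"
proof -
  have x: "embed m x \<in> punctured_space m"
    using assms by (simp add: embed_in_punctured_space)
  then show ?thesis
    using frob_class_eq[OF x, of w]
    by (auto simp: rational_points_def weighted_proj_space_def frob_embed intro: quotientI)
qed

text \<open>If Frobenius maps \<open>z\<close> to \<open>c \<cdot> z\<close> and \<open>b\<^bsup>q - 1\<^esup> = c\<^sup>-\<^sup>1\<close>, then \<open>b \<cdot> z\<close> is fixed by Frobenius.\<close>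

lemma rational_point_has_representative:
  fixes P :: "(nat \<Rightarrow> 'a::{finite,field} alg_closure) set"
  assumes "P \<in> rational_points m w"
  shows "\<exists>x :: nat \<Rightarrow> 'a. x \<in> {..m} \<rightarrow>\<^sub>E UNIV \<and> (\<exists>i\<le>m. x i \<noteq> 0) \<and> P = wp_rel m w `` {embed m x}"
proof -
  have q: "CARD('a) - 1 > 0" using card_field_ge_2[where 'a='a] by linarith
  obtain z where z: "z \<in> punctured_space m" "P = wp_rel m w `` {z}" "frob_class m w P = P"
    using assms unfolding rational_points_def weighted_proj_space_def by (auto elim: quotientE)
  have "frob m z \<in> punctured_space m"
    using z(1) by (auto simp: punctured_space_def frob_def)
  moreover have "wp_rel m w `` {z} = wp_rel m w `` {frob m z}"
    using z frob_class_eq[OF z(1), of w] by simp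
  ultimately have "(z, frob m z) \<in> wp_rel m w"
    by (intro eq_equiv_class[OF _ equiv_wp_rel])
  then obtain c where c: "c \<noteq> 0" "\<And>i. i \<le> m \<Longrightarrow> frob m z i = c ^ w i * z i"
    unfolding wp_rel_def by blast
  obtain b where b: "b ^ (CARD('a) - 1) = inverse c"
    using nth_root_exists[OF q] by blast
  have "b \<noteq> 0" using b c(1) q by (auto simp: power_0_left)
  have "b ^ w i * z i \<in> range to_ac" if "i \<le> m" for i
  proof (rule frobenius_fixed_imp_range)
    have "b ^ CARD('a) * c = b ^ (CARD('a) - 1) * b * c"
      by (subst power_minus_mult) simp_all
    also have "\<dots> = b"
      unfolding b using c(1) by simp
    finally have "b ^ CARD('a) * c = b" .
    have "(b ^ w i * z i) ^ CARD('a) = (b ^ CARD('a)) ^ w i * frob m z i"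
      using that by (simp add: frob_def power_mult_distrib mult.commute flip: power_mult)
    also have "\<dots> = (b ^ CARD('a) * c) ^ w i * z i"
      using c(2)[OF that] by (simp add: power_mult_distrib)
    finally show "(b ^ w i * z i) ^ CARD('a) = b ^ w i * z i"
      by (simp only: \<open>b ^ CARD('a) * c = b\<close>)
  qed
  then have to_of: "to_ac (of_ac (b ^ w i * z i)) = b ^ w i * z i" if "i \<le> m" for i
    using that by (intro to_ac_of_ac) auto
  define x :: "nat \<Rightarrow> 'a" where "x = (\<lambda>i\<in>{..m}. of_ac (b ^ w i * z i))"
  have embed_x: "embed m x i = b ^ w i * z i" if "i \<le> m" for i
    using to_of[OF that] that by (simp add: embed_def x_def)
  obtain i where i: "i \<le> m" "z i \<noteq> 0" using z(1) by (auto simp: punctured_space_def)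
  then have "embed m x i \<noteq> 0" using \<open>b \<noteq> 0\<close> embed_x by simp
  with i(1) have nz: "\<exists>i\<le>m. x i \<noteq> 0" by (auto simp: embed_def)
  then have "(z, embed m x) \<in> wp_rel m w"
    unfolding wp_rel_def using z(1) \<open>b \<noteq> 0\<close> embed_x by (auto simp: embed_in_punctured_space)
  then have "P = wp_rel m w `` {embed m x}"
    unfolding z(2) by (rule equiv_class_eq[OF equiv_wp_rel])
  with nz show ?thesis by (intro exI[of _ x]) (simp add: x_def)
qed

lemma eval_ac_embed: "eval_ac m f (embed m x) = to_ac (meval m f x)"
  unfolding eval_ac_to_ac[symmetric] by (simp add: eval_ac_def embed_def)

lemma embed_class_in_rational_zeros:
  assumes f: "f \<in> weighted_homogeneous m w d" and x: "\<exists>i\<le>m. x i \<noteq> 0"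
  shows "wp_rel m w `` {embed m x} \<in> rational_zeros m w f \<longleftrightarrow> meval m f x = 0"
proof -
  have "embed m x \<in> punctured_space m"
    using x by (simp add: embed_in_punctured_space)
  then have "embed m x \<in> wp_rel m w `` {embed m x}"
    by (rule equiv_class_self[OF equiv_wp_rel])
  moreover have "eval_ac m f y = 0"
    if "y \<in> wp_rel m w `` {embed m x}" "meval m f x = 0" for y
  proof -
    obtain c where "\<forall>i\<le>m. y i = c ^ w i * embed m x i"
      using \<open>y \<in> _\<close> by (auto simp: wp_rel_def)
    from eval_ac_wp_rel[OF f this] that(2) show ?thesis by (simp add: eval_ac_embed)
  qed
  ultimately show ?thesis
    unfolding rational_zeros_def using embed_class_rational[OF x, of w] eval_ac_embed[of m f x] by auto
qed

lemma finite_points: "finite ({..m::nat} \<rightarrow>\<^sub>E (UNIV :: 'a::finite set))"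
  by (rule finite_PiE) auto

text \<open>The \<open>q ^ (m + 1)\<close> vectors are the origin, the nonzeros of \<open>f\<close>,
  and the remaining zeros; the last fall into classes of \<open>q - 1\<close> vectors, one class for
  each rational zero.\<close>

lemma card_rational_zeros:
  fixes f :: "'a::{finite,field} mpoly"
  assumes f: "f \<in> weighted_homogeneous m w d" and d: "d \<ge> 1" and w: "\<And>i. i \<le> m \<Longrightarrow> w i > 0"
  shows "(CARD('a) - 1) * card (rational_zeros m w f) + 1 + card (nonzeros m f) = CARD('a) ^ (m + 1)"
proof -
  define V where "V = {x \<in> {..m} \<rightarrow>\<^sub>E UNIV. (\<exists>i\<le>m. x i \<noteq> 0) \<and> meval m f x = 0}"
  define cls where "cls x = wp_rel m w `` {embed m x}" for x :: "nat \<Rightarrow> 'a"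
  have finV: "finite V"
    unfolding V_def by (rule finite_subset[OF _ finite_points[of m]]) auto
  have image: "cls ` V = rational_zeros m w f"
  proof
    show "cls ` V \<subseteq> rational_zeros m w f"
      using embed_class_in_rational_zeros[OF f] by (auto simp: V_def cls_def)
    show "rational_zeros m w f \<subseteq> cls ` V"
    proof
      fix P assume P: "P \<in> rational_zeros m w f"
      then obtain x :: "nat \<Rightarrow> 'a" where x: "x \<in> {..m} \<rightarrow>\<^sub>E UNIV" "\<exists>i\<le>m. x i \<noteq> 0" "P = cls x"
        using rational_point_has_representative[of P m w] by (auto simp: rational_zeros_def cls_def)
      then have "x \<in> V"
        using P embed_class_in_rational_zeros[OF f x(2)] by (simp add: V_def cls_def)
      with x(3) show "P \<in> cls ` V" by blast
    qed
  qed
  have fiber: "card {x \<in> V. cls x = P} = CARD('a) - 1" if P: "P \<in> cls ` V" for P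
  proof -
    obtain x0 where x0: "x0 \<in> V" "P = cls x0" using P by blast
    have p0: "embed m x0 \<in> punctured_space m"
      using x0(1) by (simp add: V_def embed_in_punctured_space)
    have "{x \<in> V. cls x = P} = orbit_points m w x0"
    proof (intro equalityI subsetI)
      fix x assume "x \<in> {x \<in> V. cls x = P}"
      then have x: "x \<in> V" "cls x0 = cls x" using x0(2) by auto
      then have "embed m x \<in> punctured_space m"
        by (simp add: V_def embed_in_punctured_space)
      with x(2) have "(embed m x0, embed m x) \<in> wp_rel m w"
        unfolding cls_def by (rule eq_equiv_class[OF _ equiv_wp_rel])
      then obtain c where "c \<noteq> 0" "\<forall>i\<le>m. embed m x i = c ^ w i * embed m x0 i"
        by (auto simp: wp_rel_def)
      then show "x \<in> orbit_points m w x0"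
        using x(1) by (auto simp: orbit_points_def V_def embed_def)
    next
      fix x assume x: "x \<in> orbit_points m w x0"
      then obtain c :: "'a alg_closure" where c: "c \<noteq> 0" "\<And>i. i \<le> m \<Longrightarrow> to_ac (x i) = c ^ w i * to_ac (x0 i)"
        by (auto simp: orbit_points_def)
      obtain i where "i \<le> m" "x0 i \<noteq> 0" using x0(1) by (auto simp: V_def)
      then have "to_ac (x i) \<noteq> 0" using c by simp
      with \<open>i \<le> m\<close> have nz: "\<exists>i\<le>m. x i \<noteq> 0" by auto
      then have "(embed m x0, embed m x) \<in> wp_rel m w"
      proof -
        have "embed m x \<in> punctured_space m"
          using nz by (simp add: embed_in_punctured_space)
        moreover have "\<forall>i\<le>m. embed m x i = c ^ w i * embed m x0 i"
          using c(2) by (simp add: embed_def)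
        ultimately show ?thesis using p0 c(1) unfolding wp_rel_def by blast
      qed
      then have eq: "cls x0 = cls x"
        unfolding cls_def by (rule equiv_class_eq[OF equiv_wp_rel])
      have "cls x0 \<in> rational_zeros m w f" using x0(1) image by blast
      then have "meval m f x = 0"
        using embed_class_in_rational_zeros[OF f nz] eq by (simp add: cls_def)
      then show "x \<in> {x \<in> V. cls x = P}"
        using x nz eq x0(2) by (simp add: V_def orbit_points_def)
    qed
    then show ?thesis
      using card_orbit_points[where m = m and w = w and x = x0, OF w] x0(1) by (simp add: V_def)
  qed
  have "card V = (\<Sum>P\<in>cls ` V. card {x \<in> V. cls x = P})"
    using sum.image_gen[OF finV, of "\<lambda>_. 1::nat" cls] by simp
  also have "\<dots> = card (cls ` V) * (CARD('a) - 1)"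
    using fiber by simp
  finally have cardV: "card V = (CARD('a) - 1) * card (rational_zeros m w f)"
    by (simp add: image)
  define o0 where "o0 = (\<lambda>i\<in>{..m}. 0 :: 'a)"
  \<comment> \<open>Positive degree excludes a constant term, so the origin is a zero.\<close>
  have eval_o0: "meval m f o0 = 0"
    unfolding meval_def
  proof (rule sum.neutral, rule ballI)
    fix a assume "a \<in> Poly_Mapping.keys f"
    then have "a \<in> weighted_exponents m w d"
      using f by (auto simp: weighted_homogeneous_iff)
    then have "(\<Sum>i\<le>m. w i * Poly_Mapping.lookup a i) = d"
      by (simp add: weighted_exponents_def)
    moreover have "(\<Sum>i\<le>m. w i * Poly_Mapping.lookup a i) = 0"
      if "\<forall>i\<le>m. Poly_Mapping.lookup a i = 0"
      using that by simp
    ultimately have "\<not> (\<forall>i\<le>m. Poly_Mapping.lookup a i = 0)"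
      using d by (metis not_one_le_zero)
    then obtain i where "i \<le> m" "Poly_Mapping.lookup a i \<noteq> 0" by blast
    then have "(\<Prod>i\<le>m. o0 i ^ Poly_Mapping.lookup a i) = 0"
      by (intro prod_zero bexI[of _ i]) (auto simp: o0_def)
    then show "Poly_Mapping.lookup f a * (\<Prod>i\<le>m. o0 i ^ Poly_Mapping.lookup a i) = 0" by simp
  qed
  have "x = o0 \<or> x \<in> V \<or> x \<in> nonzeros m f" if "x \<in> {..m} \<rightarrow>\<^sub>E UNIV" for x
    using that unfolding V_def nonzeros_def o0_def PiE_iff extensional_def fun_eq_iff by auto
  moreover have "o0 \<in> {..m} \<rightarrow>\<^sub>E UNIV" by (simp add: o0_def)
  ultimately have split: "{..m} \<rightarrow>\<^sub>E (UNIV :: 'a set) = insert o0 V \<union> nonzeros m f"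
    unfolding V_def nonzeros_def by blast
  have "o0 \<notin> V" by (simp add: V_def o0_def)
  have "CARD('a) ^ (m + 1) = card ({..m} \<rightarrow>\<^sub>E (UNIV :: 'a set))"
    by (simp add: card_PiE)
  also have "\<dots> = card (insert o0 V) + card (nonzeros m f)"
    unfolding split
  proof (rule card_Un_disjoint)
    show "finite (nonzeros m f)"
      unfolding nonzeros_def by (rule finite_subset[OF _ finite_points[of m]]) auto
    show "insert o0 V \<inter> nonzeros m f = {}"
      using eval_o0 by (auto simp: V_def nonzeros_def)
  qed (use finV in simp)
  also have "card (insert o0 V) = Suc (card V)"
    using finV \<open>o0 \<notin> V\<close> by simp
  finally show ?thesis by (simp add: cardV)
qed

section \<open>Forms with many zeros\<close>

text \<open>Clearing the denominator \<open>q - 1\<close> keeps the later arithmetic free of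
  division. The index is shifted so that \<open>n = 0\<close> covers
  \<open>p_num q (- 1) = 0\<close>.\<close>

lemma p_num_eq:
  assumes "q \<ge> 2"
  shows "(q - 1) * p_num q (int n - 1) + 1 = q ^ n"
proof -
  have "int (q - 1) dvd int (q ^ n - 1)"
  proof -
    have "int q - 1 dvd int q ^ n - 1 ^ n"
      by (rule power_diff_sumr2[THEN dvdI])
    then show ?thesis using assms by (simp add: of_nat_diff)
  qed
  then have "(q - 1) dvd (q ^ n - 1)" by (simp only: int_dvd_int_iff)
  then have "(q - 1) * p_num q (int n - 1) = q ^ n - 1"
    by (simp add: p_num_def)
  moreover have "q ^ n > 0" using assms by simp
  ultimately show ?thesis by simp
qed

context weight_system
begin

text \<open>The witness is \<open>x_0 ^ (d - q * w 1) * (x_1 ^ q - x_1 * x_0 ^ ((q - 1) * w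
  1))\<close>. The first factor has positive exponent and handles \<open>x_0 = 0\<close>; elsewhere
  the second vanishes by Fermat.\<close>

lemma exists_vanishing_everywhere:
  assumes "CARD('a) * w 1 < d"
  shows "\<exists>f :: 'a::{finite,field} mpoly. f \<in> weighted_homogeneous m w d \<and> f \<noteq> 0 \<and> card (nonzeros m f) = 0"
proof -
  let ?q = "CARD('a)"
  define a where "a = Poly_Mapping.single (0::nat) (d - ?q * w 1) + Poly_Mapping.single 1 ?q"
  define b where "b = Poly_Mapping.single (0::nat) (d - w 1) + Poly_Mapping.single 1 1"
  define f :: "'a mpoly" where "f = Poly_Mapping.single a 1 + Poly_Mapping.single b (- 1)"
  have q: "?q \<ge> 2" by (rule card_field_ge_2)
  have w1: "w 1 < d" using assms q w_1_pos by (metis le_less_trans mult_le_mono1 nat_mult_1 order_trans one_le_numeral)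
  have "a \<in> weighted_exponents m w (w 0 * (d - ?q * w 1) + w 1 * ?q)"
    unfolding a_def using m_pos by (intro weighted_exponents_add weighted_exponents_single) auto
  moreover have "b \<in> weighted_exponents m w (w 0 * (d - w 1) + w 1 * 1)"
    unfolding b_def using m_pos by (intro weighted_exponents_add weighted_exponents_single) auto
  ultimately have ab: "a \<in> weighted_exponents m w d" "b \<in> weighted_exponents m w d"
    using assms w1 by (simp_all add: w_0 mult.commute)
  have f: "f \<in> weighted_homogeneous m w d"
    unfolding f_def by (intro weighted_homogeneous_add) (use ab in \<open>auto simp: weighted_homogeneous_iff\<close>)
  have "Poly_Mapping.lookup a 1 \<noteq> Poly_Mapping.lookup b 1"
    using q by (simp add: a_def b_def lookup_add lookup_single)
  then have "a \<noteq> b" by auto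
  then have "Poly_Mapping.lookup f a = 1"
    by (simp add: f_def lookup_add lookup_single)
  then have "f \<noteq> 0" by auto
  have "meval m f x = 0" for x
  proof -
    have "meval m f x = x 0 ^ (d - ?q * w 1) * x 1 ^ ?q - x 0 ^ (d - w 1) * x 1"
      using m_pos unfolding f_def a_def b_def meval_add meval_single lookup_add power_add prod.distrib
      by (simp add: prod_power_lookup_single)
    also have "x 0 ^ (d - ?q * w 1) = x 0 ^ (d - w 1)"
    proof (cases "x 0 = 0")
      case False
      have "d - w 1 = d - ?q * w 1 + (?q - 1) * w 1"
        using assms q by (simp add: diff_mult_distrib)
      then show ?thesis
        using finite_field_power_card_minus_1[OF False] by (simp add: power_add power_mult)
    qed (use assms w1 in \<open>simp add: power_0_left\<close>)
    finally show ?thesis by (simp add: finite_field_power_card)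
  qed
  then have "nonzeros m f = {}" by (simp add: nonzeros_def)
  with f \<open>f \<noteq> 0\<close> show ?thesis by (intro exI[of _ f]) simp
qed

text \<open>The exponent \<open>d - k * w 1\<close> of \<open>x_0\<close> is positive, so all
  nonzeros have \<open>x_0 \<noteq> 0\<close>; there exactly \<open>k\<close> values of
  \<open>x_1\<close> are excluded.\<close>

lemma exists_many_zeros:
  assumes "k < CARD('a)" "k * w 1 < d"
  shows "\<exists>f :: 'a::{finite,field} mpoly. f \<in> weighted_homogeneous m w d \<and> f \<noteq> 0 \<and>
    card (nonzeros m f) \<le> (CARD('a) - 1) * (CARD('a) - k) * CARD('a) ^ (m - 1)"
proof -
  let ?q = "CARD('a)"
  obtain T :: "'a set" where T: "card T = k"
    using obtain_subset_with_card_n[of k "UNIV :: 'a set"] assms(1) by auto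
  define g :: "'a \<Rightarrow> 'a mpoly" where "g a = mvar 1 + Poly_Mapping.single 0 (- a) * mvar 0 ^ w 1" for a
  define f where "f = mvar 0 ^ (d - k * w 1) * (\<Prod>a\<in>T. g a)"
  have "g a \<in> weighted_homogeneous m w (w 1)" for a
    unfolding g_def using m_pos weighted_homogeneous_power[OF weighted_homogeneous_mvar[of 0 m w], of "w 1"] w_0
    by (intro weighted_homogeneous_add weighted_homogeneous_mvar weighted_homogeneous_scale) auto
  then have "(\<Prod>a\<in>T. g a) \<in> weighted_homogeneous m w (\<Sum>a\<in>T. w 1)"
    by (intro weighted_homogeneous_prod)
  then have "f \<in> weighted_homogeneous m w (w 0 * (d - k * w 1) + (\<Sum>a\<in>T. w 1))"
    unfolding f_def by (intro weighted_homogeneous_mult weighted_homogeneous_power weighted_homogeneous_mvar) auto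
  then have f: "f \<in> weighted_homogeneous m w d"
    using assms(2) by (simp add: w_0 T)
  have meval: "meval m f x = x 0 ^ (d - k * w 1) * (\<Prod>a\<in>T. x 1 - a * x 0 ^ w 1)" for x
    using m_pos by (simp add: f_def g_def meval_mult meval_power meval_prod meval_add meval_single)
  obtain c where c: "c \<notin> T" using assms(1) T by (metis UNIV_eq_I less_irrefl)
  have "meval m f (\<lambda>i. if i = 1 then c else 1) \<noteq> 0"
    unfolding meval using c by (auto simp: finite_subset[OF subset_UNIV])
  then have "f \<noteq> 0" by auto
  define I where "I = {..m} - {1}"
  have I: "{..m} = insert 1 I" "1 \<notin> I" "finite I" "0 \<in> I" "card I = m"
    using m_pos by (auto simp: I_def)
  have slice: "card {b. meval m f (x(1 := b)) \<noteq> 0} \<le> (if x 0 \<noteq> 0 then ?q - k else 0)" for x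
  proof (cases "x 0 = 0")
    case True
    then show ?thesis using assms(2) by (simp add: meval)
  next
    case False
    have "{b. meval m f (x(1 := b)) \<noteq> 0} = UNIV - (\<lambda>a. a * x 0 ^ w 1) ` T"
      using False by (auto simp: meval)
    moreover have "card (UNIV - (\<lambda>a. a * x 0 ^ w 1) ` T) = ?q - card ((\<lambda>a. a * x 0 ^ w 1) ` T)"
      by (rule card_Diff_subset) auto
    moreover have "card ((\<lambda>a. a * x 0 ^ w 1) ` T) = k"
      using False T by (subst card_image) (auto simp: inj_on_def)
    ultimately have "card {b. meval m f (x(1 := b)) \<noteq> 0} = ?q - k" by (simp only:)
    then show ?thesis using False by (simp only:) simp
  qed
  have "card (nonzeros m f) = (\<Sum>x\<in>I \<rightarrow>\<^sub>E UNIV. card {b. meval m f (x(1 := b)) \<noteq> 0})"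
    unfolding nonzeros_def I(1) by (rule card_nonzero_PiE_insert) (use I in auto)
  also have "\<dots> \<le> (\<Sum>x\<in>I \<rightarrow>\<^sub>E (UNIV :: 'a set). if x 0 \<noteq> 0 then ?q - k else 0)"
    by (intro sum_mono slice)
  also have "\<dots> = card {x \<in> I \<rightarrow>\<^sub>E (UNIV :: 'a set). x 0 \<noteq> 0} * (?q - k)"
    using finite_PiE[OF I(3), of "\<lambda>_. UNIV :: 'a set"] by (simp add: sum.inter_filter[symmetric])
  also have "\<dots> = (?q - 1) * (?q - k) * ?q ^ (m - 1)"
    using card_PiE_nonzero[OF I(3,4), where 'a='a] I(5) by simp
  finally show ?thesis using f \<open>f \<noteq> 0\<close> by blast
qed

end

section \<open>From nonzeros of forms to the maximal number of zeros\<close>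

theorem theorem1p2:
  fixes m d q :: nat and w :: "nat \<Rightarrow> nat"
  assumes "q = CARD('a::{finite,field})"
    and "m \<ge> 1"
    and "\<forall>i\<le>m. w i > 0"
    and "w 0 = 1"
    and "\<forall>i<m. w i \<le> w (Suc i)"
    and "d \<ge> 1"
  shows "e_max TYPE('a) d m w =
    min (p_num q (int m)) (((d - 1) div w 1 + 1) * q ^ (m - 1) + p_num q (int m - 2))"
proof -
  define k where "k = (d - 1) div w 1"
  define M where "M = min (p_num q (int m)) ((k + 1) * q ^ (m - 1) + p_num q (int m - 2))"
  have q: "q \<ge> 2" using card_field_ge_2[where 'a='a] assms(1) by simp
  have "w 1 \<le> w i" if "1 \<le> i" "i \<le> m" for i
    using that
  proof (induction i rule: dec_induct)
    case (step n)
    then show ?case using assms(5) by (meson Suc_leD Suc_le_lessD order_trans)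
  qed simp
  then interpret weight_system m w
    using assms(2-4) by unfold_locales auto
  have pm: "(q - 1) * p_num q (int m) + 1 = q ^ (m + 1)"
    using p_num_eq[OF q, of "m + 1"] by simp
  have pm2: "(q - 1) * p_num q (int m - 2) + 1 = q ^ (m - 1)"
    using p_num_eq[OF q, of "m - 1"] assms(2) by (simp add: of_nat_diff algebra_simps)
  have qm: "q ^ (m + 1) = q * q * q ^ (m - 1)"
    using assms(2) by (simp add: power_eq_if)
  have zeros: "(q - 1) * card (rational_zeros m w f) + 1 + card (nonzeros m f) = q ^ (m + 1)"
    if "f \<in> weighted_homogeneous m w d" for f :: "'a mpoly"
    using card_rational_zeros[OF that assms(6)] assms(1,3) by simp
  have cancel: "x \<le> y" if "(q - 1) * x \<le> (q - 1) * y" for x y :: nat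
    using that q by simp
  \<comment> \<open>For \<open>k < q\<close> the claimed maximum and the least number of nonzeros
    are complementary in \<open>q ^ (m + 1)\<close>, so bounds on the nonzeros translate directly
    into bounds on the zeros.\<close>
  have bound: "(q - 1) * M + 1 + (q - 1) * (q - k) * q ^ (m - 1) = q ^ (m + 1)" if "k < q"
  proof -
    obtain u where u: "q = Suc k + u" using \<open>k < q\<close> le_Suc_ex[of "Suc k" q] by auto
    have eq: "(q - 1) * ((k + 1) * q ^ (m - 1) + p_num q (int m - 2)) + 1 + (q - 1) * (q - k) * q ^ (m - 1) = q ^ (m + 1)"
    proof -
      have "(q - 1) * (k + 1) + 1 + (q - 1) * (q - k) = q * q"
        by (simp add: u algebra_simps)
      then have eq: "((q - 1) * (k + 1) + 1 + (q - 1) * (q - k)) * q ^ (m - 1) = q ^ (m + 1)"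
        by (simp only: qm)
      have expand: "A * (B * C + D) + 1 + A * E * C = (A * B + 1 + A * E) * C"
        if "A * D + 1 = C" for A B C D E :: nat
      proof -
        have "A * (B * C + D) + 1 + A * E * C = A * B * C + (A * D + 1) + A * E * C"
          by (simp add: algebra_simps)
        then show ?thesis by (simp only: that distrib_right mult_1)
      qed
      show ?thesis
        unfolding expand[OF pm2] by (rule eq)
    qed
    then have "(k + 1) * q ^ (m - 1) + p_num q (int m - 2) \<le> p_num q (int m)"
      using pm by - (rule cancel, linarith)
    then show ?thesis using eq by (simp add: M_def)
  qed
  \<comment> \<open>The second expression equals \<open>p_m\<close> if its coefficient of
    \<open>q ^ (m - 1)\<close> is \<open>q + 1\<close>; for \<open>k \<ge> q\<close> the coefficient
    is at least that large.\<close>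
  have M_large: "M = p_num q (int m)" if "\<not> k < q"
  proof -
    have "(q - 1) * (q + 1) + 1 = q * q"
    proof -
      obtain u where "q = Suc u" using q by (cases q) auto
      then show ?thesis by simp
    qed
    then have eq: "((q - 1) * (q + 1) + 1) * q ^ (m - 1) = q ^ (m + 1)"
      by (simp only: qm)
    have "(q - 1) * ((q + 1) * q ^ (m - 1) + p_num q (int m - 2)) + 1 =
        (q - 1) * ((q + 1) * q ^ (m - 1)) + ((q - 1) * p_num q (int m - 2) + 1)"
      by (simp only: distrib_left add.assoc)
    also have "\<dots> = ((q - 1) * (q + 1) + 1) * q ^ (m - 1)"
      by (simp only: pm2 distrib_right mult.assoc mult_1)
    finally have "p_num q (int m) \<le> (q + 1) * q ^ (m - 1) + p_num q (int m - 2)"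
      unfolding eq using pm by - (rule cancel, linarith)
    also have "(q + 1) * q ^ (m - 1) \<le> (k + 1) * q ^ (m - 1)"
      using that by (intro mult_le_mono1) linarith
    finally have "p_num q (int m) \<le> (k + 1) * q ^ (m - 1) + p_num q (int m - 2)"
      by simp
    then show ?thesis by (simp add: M_def)
  qed
  have upper: "card (rational_zeros m w f) \<le> M"
    if f: "f \<in> weighted_homogeneous m w d" "f \<noteq> 0" for f :: "'a mpoly"
  proof (cases "k < q")
    case True
    interpret weighted_form m w d k f
      using f assms(1,6) True by unfold_locales (auto simp: k_def)
    have "(q - 1) * (q - k) * q ^ (m - 1) \<le> card (nonzeros m f)"
      using nonzeros_lower_bound by (simp add: assms(1))
    then show ?thesis
      using zeros[OF f(1)] bound[OF True] by - (rule cancel, linarith)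
  next
    case False
    then show ?thesis
      unfolding M_large[OF False] using zeros[OF f(1)] pm by - (rule cancel, linarith)
  qed
  have "\<exists>f :: 'a mpoly. f \<in> weighted_homogeneous m w d \<and> f \<noteq> 0 \<and> M \<le> card (rational_zeros m w f)"
  proof (cases "k < q")
    case True
    have "k * w 1 \<le> d - 1" unfolding k_def by (rule div_times_less_eq_dividend)
    then have "k * w 1 < d" using assms(6) by linarith
    then obtain f :: "'a mpoly" where f: "f \<in> weighted_homogeneous m w d" "f \<noteq> 0"
      "card (nonzeros m f) \<le> (q - 1) * (q - k) * q ^ (m - 1)"
      using exists_many_zeros[where 'a='a, of k d] True assms(1) by blast
    then have "M \<le> card (rational_zeros m w f)"
      using zeros[OF f(1)] bound[OF True] by - (rule cancel, linarith)
    with f show ?thesis by blast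
  next
    case False
    have "q * w 1 < d"
    proof -
      have "q * w 1 \<le> k * w 1" using False by simp
      also have "\<dots> \<le> d - 1" unfolding k_def by (rule div_times_less_eq_dividend)
      finally show ?thesis using assms(6) by linarith
    qed
    then obtain f :: "'a mpoly" where f: "f \<in> weighted_homogeneous m w d" "f \<noteq> 0" "card (nonzeros m f) = 0"
      using exists_vanishing_everywhere[where 'a='a, of d] assms(1) by blast
    have "M \<le> card (rational_zeros m w f)"
      unfolding M_large[OF False] using zeros[OF f(1)] pm f(3) by - (rule cancel, linarith)
    with f show ?thesis by blast
  qed
  then obtain f :: "'a mpoly" where f: "f \<in> weighted_homogeneous m w d" "f \<noteq> 0" "card (rational_zeros m w f) = M"
    using upper by (meson le_antisym)
  have "e_max TYPE('a) d m w = M"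
    unfolding e_max_def
  proof (rule Max_eqI)
    show "finite {card (rational_zeros m w f) | f :: 'a mpoly. f \<in> weighted_homogeneous m w d \<and> f \<noteq> 0}"
      by (rule finite_subset[of _ "{..M}"]) (use upper in auto)
    show "y \<le> M" if "y \<in> {card (rational_zeros m w f) | f :: 'a mpoly. f \<in> weighted_homogeneous m w d \<and> f \<noteq> 0}" for y
      using that upper by auto
    show "M \<in> {card (rational_zeros m w f) | f :: 'a mpoly. f \<in> weighted_homogeneous m w d \<and> f \<noteq> 0}"
      using f by auto
  qed
  then show ?thesis by (simp add: M_def k_def)
qed

end
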